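(* Let $G$ be a metric group having a presentation $G=\bigcup_{i\in\omega}K_i$ as the union of an increasing sequence of closed subsets of bounded diameters, with $\{1\}\cup K_n\cdot K_n\cup K_n^{-1}\subseteq K_{n+1}$ and the operations $K_n\times K_n\to K_{n+1}$, $K_n\to K_{n+1}$ uniformly continuous with respect to fixed continuity moduli $\mathcal{F}_0$, such that there is an isometric action of $G$ on a real Hilbert space which induces a structure from $\mathcal{K}_{GH}(\nu,\mathcal{F})$ and has no fixed points. Then for any infinite subset $C\subset G$ there is a closed continuously elementary subgroup of $G$ which contains $C$, has the same density character as $C$, and does not have property $\mathbf{FH}$ for $\mathcal{F}$-actions.
   Context: A metric group is a group with a complete metric. "Bounded diameters" means each $K_i$ has finite diameter. The density character is the smallest cardinality of a dense subset. A continuity modulus $\gamma$ for a map of several variables means: if one argument is changed by distance less than $\gamma(\varepsilon)$, the value changes by less than $\varepsilon$. Fix $\nu:\omega\times\omega\to\omega$ increasing in each argument. Hilbert spaces are infinite dimensional; a real Hilbert space $\mathbf H$ is regarded as a many-sorted metric structure whose sorts are the balls $B_n$ of vectors of norm $\le n$, with $0$, the inclusions $B_m\to B_n$ ($m<n$), scalar multiplications by $r\in\mathbb{R}$, addition and subtraction $B_n\times B_n\to B_{2n}$, and the inner product $B_n\times B_n\to[-n^2,n^2]$. $\mathcal{F}$ is a family of continuity moduli, one for each of the action maps from $K_n\times B_m$. $\mathcal{K}_{GH}(\nu,\mathcal{F})$ is the class of many-sorted metric structures consisting of a group structure $(\{K_n\}_{n\in\omega},\cdot,{}^{-1},1)$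 as in the claim, a real Hilbert space structure, and an operation $\circ$ defining an isometric action of $G=\bigcup K_n$ on $\mathbf H$, given by maps $K_n\times B_m\to B_{\nu(n,m)}$ with continuity moduli $\mathcal{F}$. An $\mathcal{F}$-action is an isometric action on a real Hilbert space whose restrictions to $K_n\times B_m$ have the continuity moduli $\mathcal{F}$; a group has property $\mathbf{FH}$ for $\mathcal{F}$-actions if each of its $\mathcal{F}$-actions has a fixed point. For a closed subgroup $H\le G$ this is taken with respect to $H=\bigcup_i(K_i\cap H)$. A closed subgroup $H$ is continuously elementary if $(\{K_n\cap H\},\cdot,{}^{-1},1)$ is an elementary substructure of $(\{K_n\},\cdot,{}^{-1},1)$: every continuous formula (built from atomic formulas by continuous connectives and $\sup,\inf$ over sorts) has, at every tuple from $H$, the same value in both structures. *)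

theory Defs
  imports "HOL-Analysis.Analysis" "HOL-Algebra.Group_Action"
begin

section \<open>Continuity moduli\<close>

definition modulus :: "(real \<Rightarrow> real) \<Rightarrow> bool" where
  "modulus \<gamma> \<longleftrightarrow> (\<forall>\<epsilon>>0. \<gamma> \<epsilon> > 0)"

definition has_modulus ::
  "(real \<Rightarrow> real) \<Rightarrow> 'a set \<Rightarrow> ('a \<Rightarrow> 'a \<Rightarrow> real) \<Rightarrow> ('b \<Rightarrow> 'b \<Rightarrow> real) \<Rightarrow> ('a \<Rightarrow> 'b) \<Rightarrow> bool" where
  "has_modulus \<gamma> A dA dB f \<longleftrightarrow>
     (\<forall>\<epsilon>>0. \<forall>x\<in>A. \<forall>y\<in>A. dA x y < \<gamma> \<epsilon> \<longrightarrow> dB (f x) (f y) < \<epsilon>)"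

definition has_modulus2 ::
  "(real \<Rightarrow> real) \<Rightarrow> 'a set \<Rightarrow> ('a \<Rightarrow> 'a \<Rightarrow> real) \<Rightarrow> 'b set \<Rightarrow> ('b \<Rightarrow> 'b \<Rightarrow> real)
    \<Rightarrow> ('c \<Rightarrow> 'c \<Rightarrow> real) \<Rightarrow> ('a \<Rightarrow> 'b \<Rightarrow> 'c) \<Rightarrow> bool" where
  "has_modulus2 \<gamma> A dA B dB dC f \<longleftrightarrow>
     (\<forall>y\<in>B. has_modulus \<gamma> A dA dC (\<lambda>x. f x y)) \<and>
     (\<forall>x\<in>A. has_modulus \<gamma> B dB dC (f x))"

section \<open>Metric groups and their presentations\<close>

locale metric_group = group G + Metric_space "carrier G" d
  for G :: "('g, 'm) monoid_scheme" (structure) and d :: "'g \<Rightarrow> 'g \<Rightarrow> real" +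
  assumes complete: "mcomplete"

text \<open>The family of moduli for the group operations consists of \<open>\<gamma>m n\<close> for the multiplication
  and \<open>\<gamma>i n\<close> for the inversion on \<open>K n\<close>.\<close>

locale metric_group_presentation = metric_group G d
  for G :: "('g, 'm) monoid_scheme" (structure) and d :: "'g \<Rightarrow> 'g \<Rightarrow> real" +
  fixes K :: "nat \<Rightarrow> 'g set" and \<gamma>m \<gamma>i :: "nat \<Rightarrow> real \<Rightarrow> real"
  assumes carrier_eq: "carrier G = (\<Union>n. K n)"
    and incseq_K: "incseq K"
    and closed_K: "\<And>n. closedin mtopology (K n)"
    and bounded_K: "\<And>n. mbounded (K n)"
    and one_in_K: "\<And>n. \<one> \<in> K (Suc n)"
    and mult_in_K: "\<And>n x y. \<lbrakk>x \<in> K n; y \<in> K n\<rbrakk> \<Longrightarrow> x \<otimes> y \<in> K (Suc n)"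
    and inv_in_K: "\<And>n x. x \<in> K n \<Longrightarrow> inv x \<in> K (Suc n)"
    and modulus_\<gamma>m: "\<And>n. modulus (\<gamma>m n)"
    and modulus_\<gamma>i: "\<And>n. modulus (\<gamma>i n)"
    and mult_modulus: "\<And>n. has_modulus2 (\<gamma>m n) (K n) d (K n) d d (\<lambda>x y. x \<otimes> y)"
    and inv_modulus: "\<And>n. has_modulus (\<gamma>i n) (K n) d d (\<lambda>x. inv x)"

section \<open>Isometric actions on Hilbert spaces\<close>

text \<open>A Hilbert space is rendered as a complete subspace of an ambient inner product space, so
  that closed subspaces of a Hilbert space are again Hilbert spaces over the same type.
  Hilbert spaces are infinite dimensional throughout.\<close>

definition hilbert_space :: "'v::real_inner set \<Rightarrow> bool" where
  "hilbert_space V \<longleftrightarrow>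
     subspace V \<and> complete V \<and> \<not> (\<exists>B. finite B \<and> V \<subseteq> span B)"

definition hball :: "'v::real_inner set \<Rightarrow> nat \<Rightarrow> 'v set" where
  "hball V m = {v \<in> V. norm v \<le> real m}"

text \<open>The action is by arbitrary isometries; these need not fix the origin.\<close>

definition isometric_action ::
  "('g, 'm) monoid_scheme \<Rightarrow> 'v::real_inner set \<Rightarrow> ('g \<Rightarrow> 'v \<Rightarrow> 'v) \<Rightarrow> bool" where
  "isometric_action G V \<alpha> \<longleftrightarrow>
     hilbert_space V \<and> group_action G V \<alpha> \<and>
     (\<forall>g\<in>carrier G. \<forall>v\<in>V. \<forall>w\<in>V. dist (\<alpha> g v) (\<alpha> g w) = dist v w)"

definition F_action ::
  "(nat \<Rightarrow> nat \<Rightarrow> real \<Rightarrow> real) \<Rightarrow> ('g, 'm) monoid_scheme \<Rightarrow> ('g \<Rightarrow> 'g \<Rightarrow> real) \<Rightarrow> (nat \<Rightarrow> 'g set)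
    \<Rightarrow> 'v::real_inner set \<Rightarrow> ('g \<Rightarrow> 'v \<Rightarrow> 'v) \<Rightarrow> bool" where
  "F_action F G d K V \<alpha> \<longleftrightarrow>
     isometric_action G V \<alpha> \<and>
     (\<forall>n m. has_modulus2 (F n m) (K n) d (hball V m) dist dist \<alpha>)"

definition fixed_point ::
  "('g, 'm) monoid_scheme \<Rightarrow> ('g \<Rightarrow> 'v \<Rightarrow> 'v) \<Rightarrow> 'v \<Rightarrow> bool" where
  "fixed_point G \<alpha> v \<longleftrightarrow> (\<forall>g\<in>carrier G. \<alpha> g v = v)"

text \<open>HOL cannot quantify over all Hilbert spaces inside a formula; the Hilbert spaces here are
  those contained in the ambient type \<open>'v\<close>. Failure of this property for some \<open>'v\<close>
  implies failure of the unrestricted property.\<close>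

definition property_FH ::
  "'v::real_inner itself \<Rightarrow> (nat \<Rightarrow> nat \<Rightarrow> real \<Rightarrow> real) \<Rightarrow> ('g, 'm) monoid_scheme
    \<Rightarrow> ('g \<Rightarrow> 'g \<Rightarrow> real) \<Rightarrow> (nat \<Rightarrow> 'g set) \<Rightarrow> bool" where
  "property_FH (_ :: 'v itself) F G d K \<longleftrightarrow>
     (\<forall>(V :: 'v set) \<alpha>. F_action F G d K V \<alpha> \<longrightarrow> (\<exists>v\<in>V. fixed_point G \<alpha> v))"

text \<open>The class \<open>\<K>\<^sub>G\<^sub>H(\<nu>, F)\<close>. The Hilbert space sorts and operations are determined by \<open>V\<close>.\<close>

locale K_GH_structure = metric_group_presentation G d K \<gamma>m \<gamma>i
  for G :: "('g, 'm) monoid_scheme" (structure) and d :: "'g \<Rightarrow> 'g \<Rightarrow> real"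
    and K :: "nat \<Rightarrow> 'g set" and \<gamma>m \<gamma>i :: "nat \<Rightarrow> real \<Rightarrow> real" +
  fixes \<nu> :: "nat \<Rightarrow> nat \<Rightarrow> nat" and F :: "nat \<Rightarrow> nat \<Rightarrow> real \<Rightarrow> real"
    and V :: "'v::real_inner set" and \<alpha> :: "'g \<Rightarrow> 'v \<Rightarrow> 'v"
  assumes action: "F_action F G d K V \<alpha>"
    and action_ball: "\<And>n m g v. \<lbrakk>g \<in> K n; v \<in> hball V m\<rbrakk> \<Longrightarrow> \<alpha> g v \<in> hball V (\<nu> n m)"

section \<open>Continuous logic over the sorts of a presentation\<close>

text \<open>\<open>Var n i\<close> is the \<open>i\<close>-th variable of sort \<open>K n\<close>, and \<open>One n\<close> is the constant \<open>1\<close> of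
  sort \<open>K (Suc n)\<close>.\<close>

datatype gterm = Var nat nat | One nat | Mult gterm gterm | Inv gterm

inductive has_sort :: "gterm \<Rightarrow> nat \<Rightarrow> bool" where
  "has_sort (Var n i) n"
| "has_sort (One n) (Suc n)"
| "\<lbrakk>has_sort s n; has_sort t n\<rbrakk> \<Longrightarrow> has_sort (Mult s t) (Suc n)"
| "has_sort t n \<Longrightarrow> has_sort (Inv t) (Suc n)"

primrec term_vars :: "gterm \<Rightarrow> (nat \<times> nat) set" where
  "term_vars (Var n i) = {(n, i)}"
| "term_vars (One n) = {}"
| "term_vars (Mult s t) = term_vars s \<union> term_vars t"
| "term_vars (Inv t) = term_vars t"

primrec term_val :: "('g, 'm) monoid_scheme \<Rightarrow> (nat \<times> nat \<Rightarrow> 'g) \<Rightarrow> gterm \<Rightarrow> 'g" where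
  "term_val G e (Var n i) = e (n, i)"
| "term_val G e (One n) = \<one>\<^bsub>G\<^esub>"
| "term_val G e (Mult s t) = term_val G e s \<otimes>\<^bsub>G\<^esub> term_val G e t"
| "term_val G e (Inv t) = inv\<^bsub>G\<^esub> (term_val G e t)"

text \<open>\<open>Conn u \<phi>s\<close> applies to the \<open>k\<close> formulas in \<open>\<phi>s\<close> a continuous connective
  \<open>u : \<real>\<^sup>k \<rightarrow> \<real>\<close>, where \<open>\<real>\<^sup>k\<close> is the set of extensional functions on \<open>{..<k}\<close>.
  \<open>QSup n i \<phi>\<close> and \<open>QInf n i \<phi>\<close> bind the variable \<open>Var n i\<close>.\<close>

datatype cformula =
    Dist gterm gterm
  | Conn "(nat \<Rightarrow> real) \<Rightarrow> real" "cformula list"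
  | QSup nat nat cformula
  | QInf nat nat cformula

fun well_formed :: "cformula \<Rightarrow> bool" where
  "well_formed (Dist s t) \<longleftrightarrow> (\<exists>n. has_sort s n \<and> has_sort t n)"
| "well_formed (Conn u \<phi>s) \<longleftrightarrow>
     continuous_map (powertop_real {..<length \<phi>s}) euclideanreal u \<and>
     (\<forall>\<phi>\<in>set \<phi>s. well_formed \<phi>)"
| "well_formed (QSup n i \<phi>) \<longleftrightarrow> well_formed \<phi>"
| "well_formed (QInf n i \<phi>) \<longleftrightarrow> well_formed \<phi>"

fun free_vars :: "cformula \<Rightarrow> (nat \<times> nat) set" where
  "free_vars (Dist s t) = term_vars s \<union> term_vars t"
| "free_vars (Conn u \<phi>s) = (\<Union>\<phi>\<in>set \<phi>s. free_vars \<phi>)"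
| "free_vars (QSup n i \<phi>) = free_vars \<phi> - {(n, i)}"
| "free_vars (QInf n i \<phi>) = free_vars \<phi> - {(n, i)}"

fun formula_val ::
  "('g, 'm) monoid_scheme \<Rightarrow> ('g \<Rightarrow> 'g \<Rightarrow> real) \<Rightarrow> (nat \<Rightarrow> 'g set)
    \<Rightarrow> (nat \<times> nat \<Rightarrow> 'g) \<Rightarrow> cformula \<Rightarrow> real" where
  "formula_val G d K e (Dist s t) = d (term_val G e s) (term_val G e t)"
| "formula_val G d K e (Conn u \<phi>s) =
     u (\<lambda>i\<in>{..<length \<phi>s}. map (formula_val G d K e) \<phi>s ! i)"
| "formula_val G d K e (QSup n i \<phi>) = (SUP a\<in>K n. formula_val G d K (e((n, i) := a)) \<phi>)"
| "formula_val G d K e (QInf n i \<phi>) = (INF a\<in>K n. formula_val G d K (e((n, i) := a)) \<phi>)"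

text \<open>Only the free variables of the formula are required to take values in \<open>H\<close>, so the
  condition is not vacuous when some \<open>K n \<inter> H\<close> is empty.\<close>

definition continuously_elementary ::
  "('g, 'm) monoid_scheme \<Rightarrow> ('g \<Rightarrow> 'g \<Rightarrow> real) \<Rightarrow> (nat \<Rightarrow> 'g set) \<Rightarrow> 'g set \<Rightarrow> bool" where
  "continuously_elementary G d K H \<longleftrightarrow>
     (\<forall>\<phi> e. well_formed \<phi> \<longrightarrow> (\<forall>(n, i)\<in>free_vars \<phi>. e (n, i) \<in> K n \<inter> H) \<longrightarrow>
        formula_val (G\<lparr>carrier := H\<rparr>) d (\<lambda>n. K n \<inter> H) e \<phi> = formula_val G d K e \<phi>)"

section \<open>Density character\<close>

definition dense_subset :: "'a topology \<Rightarrow> 'a set \<Rightarrow> bool" where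
  "dense_subset T D \<longleftrightarrow> D \<subseteq> topspace T \<and> T closure_of D = topspace T"

definition density_character :: "'a topology \<Rightarrow> 'a rel" where
  "density_character T =
     card_of (SOME D. dense_subset T D \<and>
       (\<forall>D'. dense_subset T D' \<longrightarrow> ordLeq3 (card_of D) (card_of D')))"

lemma density_character_least:
  "\<exists>D. dense_subset T D \<and> density_character T = card_of D \<and>
     (\<forall>D'. dense_subset T D' \<longrightarrow> ordLeq3 (density_character T) (card_of D'))"
proof -
  let ?R = "card_of ` {D. dense_subset T D}"
  have "dense_subset T (topspace T)"
    by (simp add: dense_subset_def)
  then have "?R \<noteq> {}" by blast
  moreover have "\<forall>r\<in>?R. Card_order r" using card_of_Card_order by blast
  ultimately obtain r where "r \<in> ?R" "\<forall>r'\<in>?R. ordLeq3 r r'"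
    using exists_minim_Card_order[of ?R] by blast
  then have "\<exists>D. dense_subset T D \<and>
      (\<forall>D'. dense_subset T D' \<longrightarrow> ordLeq3 (card_of D) (card_of D'))"
    by blast
  from someI_ex[OF this] show ?thesis
    unfolding density_character_def by blast
qed

end

theory Submission
  imports Defs
begin

text \<open>
  The Hilbert space \<open>V\<close> can be kept, and only the group has to be cut down: if the action of a
  subgroup \<open>H\<close> on \<open>V\<close> has no fixed point, then \<open>H\<close> fails property FH. An isometric action on a
  Hilbert space with a bounded orbit fixes the circumcentre of that orbit. So the orbit of the
  origin under \<open>G\<close> is unbounded, and countably many elements \<open>g n\<close> of \<open>G\<close> already exclude fixed
  points for every subgroup that contains them (\<open>no_fixed_point_witnesses\<close>). It remains to find
  a closed elementary subgroup that contains the \<open>g n\<close> and a dense subset of \<open>C\<close> and has the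
  density character of \<open>C\<close>. This is a downward Loewenheim-Skolem theorem for continuous logic.

  There are continuum many connectives, so closing a set under witnesses for all formulas would be
  too expensive when \<open>C\<close> is separable. But all formulas are bounded, and on a bounded region a
  connective is uniformly approximated by step functions with rational data. The formulas built
  from such step functions form a countable set which is uniformly dense among all formulas
  (\<open>codes_dense\<close>). Their discontinuity is harmless, because uniform continuity is only ever
  used for the formulas that they approximate. A Skolem hull \<open>D\<close> for this countable set exists within the
  permitted cardinality (\<open>exists_tarski_vaught\<close>), and \<open>H\<close> is its closure.

  The topology of \<open>G\<close> is only loosely related to the sets \<open>K n\<close>: the group operations are
  continuous on each \<open>K n\<close>, but a convergent sequence need not stay in any of them. So it has to be
  shown that the points of \<open>H \<inter> K n\<close> are limits of points of \<open>D \<inter> K n\<close> (\<open>closure_sort_approx\<close>).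
  This follows from the Tarski-Vaught property of \<open>D\<close>, applied to distances. Then \<open>H\<close> is a
  subgroup by the continuity of the operations on the sorts, and it passes the Tarski-Vaught test for
  all formulas by their uniform continuity (\<open>tarski_vaught_test\<close>).
\<close>

unbundle cardinal_syntax

section \<open>Fixed points of isometric actions\<close>

lemma bdd_above_dist_power2:
  assumes "bounded X"
  shows "bdd_above ((\<lambda>x. (dist v x)\<^sup>2) ` X)"
proof -
  obtain B where "\<And>x. x \<in> X \<Longrightarrow> dist v x \<le> B"
    using assms bounded_any_center[of X v] by auto
  then show ?thesis
    by (intro bdd_aboveI2[of _ _ "B\<^sup>2"] power_mono) auto
qed

text \<open>The parallelogram law at the midpoint of two points whose suprema of squared distances to
  \<open>X\<close> are close to the infimum \<open>R\<close> of such suprema over \<open>V\<close> bounds the distance of the two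
  points. So minimising sequences are Cauchy, and their limit is the only minimiser.\<close>

lemma circumcentre:
  fixes V :: "'v::real_inner set"
  defines "\<rho> \<equiv> \<lambda>X v. SUP x\<in>X. (dist v x)\<^sup>2"
  assumes "subspace V" "complete V" "X \<noteq> {}" "bounded X"
  obtains c where "c \<in> V" "\<And>v. \<lbrakk>v \<in> V; \<rho> X v \<le> \<rho> X c\<rbrakk> \<Longrightarrow> v = c"
proof -
  note bdd = bdd_above_dist_power2[OF assms(5)]
  have upper: "(dist v x)\<^sup>2 \<le> \<rho> X v" if "x \<in> X" for v x
    unfolding \<rho>_def by (intro cSUP_upper that bdd)
  have nonneg: "0 \<le> \<rho> X v" for v
  proof -
    obtain x where "x \<in> X" using assms(4) by auto
    then show ?thesis using upper[of x v] zero_le_power2[of "dist v x"] by linarith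
  qed
  define R where "R = (INF v\<in>V. \<rho> X v)"
  have "V \<noteq> {}" using assms(2) subspace_0 by blast
  have R_le: "R \<le> \<rho> X v" if "v \<in> V" for v
    unfolding R_def using that nonneg by (intro cINF_lower bdd_belowI2[of _ 0]) auto
  have close: "(dist v w)\<^sup>2 \<le> 2 * (\<rho> X v - R) + 2 * (\<rho> X w - R)"
    if "v \<in> V" "w \<in> V" for v w
  proof -
    let ?m = "(1/2) *\<^sub>R (v + w)"
    have "(dist ?m x)\<^sup>2 \<le> (\<rho> X v + \<rho> X w) / 2 - (dist v w)\<^sup>2 / 4" if "x \<in> X" for x
    proof -
      have eq: "?m - x = (1/2) *\<^sub>R ((v - x) + (w - x))"
        by (simp add: algebra_simps flip: scaleR_add_left)
      have "(dist ?m x)\<^sup>2 = ((dist v x)\<^sup>2 + (dist w x)\<^sup>2) / 2 - (dist v w)\<^sup>2 / 4"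
      proof -
        have "v - w = (v - x) - (w - x)" by simp
        then show ?thesis
          unfolding dist_norm eq power2_norm_eq_inner
          by (simp add: inner_simps inner_commute algebra_simps field_simps)
      qed
      then show ?thesis using upper[OF that, of v] upper[OF that, of w] by argo
    qed
    then have "(SUP x\<in>X. (dist ?m x)\<^sup>2) \<le> (\<rho> X v + \<rho> X w) / 2 - (dist v w)\<^sup>2 / 4"
      by (intro cSUP_least assms(4)) auto
    then have "\<rho> X ?m \<le> (\<rho> X v + \<rho> X w) / 2 - (dist v w)\<^sup>2 / 4"
      by (simp add: \<rho>_def)
    moreover have "?m \<in> V"
      using that assms(2) by (simp add: subspace_add subspace_scale)
    ultimately show ?thesis using R_le[of ?m] by argo
  qed
  have "\<exists>v\<in>V. \<rho> X v < R + inverse (real (Suc n))" for n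
  proof (rule ccontr)
    assume "\<not> ?thesis"
    then have "R + inverse (real (Suc n)) \<le> R"
      unfolding R_def using \<open>V \<noteq> {}\<close> by (intro cINF_greatest) (auto simp: R_def not_less)
    then show False by simp
  qed
  then obtain s where s: "\<And>n. s n \<in> V" "\<And>n. \<rho> X (s n) < R + inverse (real (Suc n))"
    by metis
  have "Cauchy s"
  proof (rule metric_CauchyI)
    fix e :: real assume "e > 0"
    obtain N where N: "inverse (real (Suc N)) < e\<^sup>2 / 4"
      using reals_Archimedean[of "e\<^sup>2 / 4"] \<open>e > 0\<close> by auto
    have small: "\<rho> X (s n) - R < e\<^sup>2 / 4" if "n \<ge> N" for n
    proof -
      have "inverse (real (Suc n)) \<le> inverse (real (Suc N))"
        using that by (intro le_imp_inverse_le) auto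
      then show ?thesis using s(2)[of n] N by linarith
    qed
    have "dist (s m) (s n) < e" if "m \<ge> N" "n \<ge> N" for m n
    proof -
      have "(dist (s m) (s n))\<^sup>2 < e\<^sup>2"
        using close[OF s(1) s(1), of m n] small[OF that(1)] small[OF that(2)] by argo
      then show ?thesis
        using \<open>e > 0\<close> power_less_imp_less_base by fastforce
    qed
    then show "\<exists>M. \<forall>m\<ge>M. \<forall>n\<ge>M. dist (s m) (s n) < e" by blast
  qed
  then obtain c where c: "c \<in> V" "s \<longlonglongrightarrow> c"
    using assms(3) s(1) completeE by metis
  have "\<rho> X c \<le> R"
    unfolding \<rho>_def
  proof (intro cSUP_least assms(4))
    fix x assume "x \<in> X"
    have "(\<lambda>n. (dist (s n) x)\<^sup>2) \<longlonglongrightarrow> (dist c x)\<^sup>2"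
      by (intro tendsto_intros c)
    moreover have "(\<lambda>n. R + inverse (real (Suc n))) \<longlonglongrightarrow> R + 0"
      by (intro tendsto_intros LIMSEQ_inverse_real_of_nat)
    moreover have "(dist (s n) x)\<^sup>2 \<le> R + inverse (real (Suc n))" for n
      using upper[OF \<open>x \<in> X\<close>, of "s n"] s(2)[of n] by linarith
    ultimately show "(dist c x)\<^sup>2 \<le> R"
      using LIMSEQ_le by (metis (no_types, lifting) add.right_neutral)
  qed
  show thesis
  proof
    show "c \<in> V" by fact
    fix v assume v: "v \<in> V" "\<rho> X v \<le> \<rho> X c"
    then have "(dist v c)\<^sup>2 \<le> 0"
      using close[OF v(1) c(1)] \<open>\<rho> X c \<le> R\<close> by argo
    then show "v = c" by simp
  qed
qed

text \<open>A group element permutes the orbit, hence it maps the circumcentre of the orbit to a point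
  with the same circumradius, which is the circumcentre again.\<close>

lemma bounded_orbit_imp_fixed_point:
  fixes G (structure)
  assumes "isometric_action G V \<alpha>" and bdd: "bounded ((\<lambda>g. \<alpha> g 0) ` carrier G)"
  shows "\<exists>v\<in>V. fixed_point G \<alpha> v"
proof -
  interpret group_action G V \<alpha> using assms(1) by (simp add: isometric_action_def)
  interpret group G using group_hom group_hom.axioms by blast
  have V: "subspace V" "complete V" and
    iso: "\<And>g v w. \<lbrakk>g \<in> carrier G; v \<in> V; w \<in> V\<rbrakk> \<Longrightarrow> dist (\<alpha> g v) (\<alpha> g w) = dist v w"
    using assms(1) by (auto simp: isometric_action_def hilbert_space_def)
  have "0 \<in> V" using V subspace_0 by blast
  let ?X = "(\<lambda>g. \<alpha> g 0) ` carrier G"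
  have "?X \<noteq> {}" using one_closed by blast
  then obtain c where c: "c \<in> V"
    "\<And>v. \<lbrakk>v \<in> V; (SUP x\<in>?X. (dist v x)\<^sup>2) \<le> (SUP x\<in>?X. (dist c x)\<^sup>2)\<rbrakk> \<Longrightarrow> v = c"
    using circumcentre[OF V _ bdd] by metis
  have "\<alpha> g c = c" if g: "g \<in> carrier G" for g
  proof (rule c(2))
    show "\<alpha> g c \<in> V" using element_image[OF g c(1)] by simp
    have "dist (\<alpha> g c) (\<alpha> h 0) = dist c (\<alpha> (inv g \<otimes> h) 0)" if h: "h \<in> carrier G" for h
    proof -
      let ?k = "inv g \<otimes> h"
      have k: "?k \<in> carrier G" "g \<otimes> ?k = h"
        using g h by (auto simp flip: m_assoc)
      have "\<alpha> h 0 = \<alpha> g (\<alpha> ?k 0)"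
        using composition_rule[OF \<open>0 \<in> V\<close> g k(1)] k(2) by simp
      moreover have "\<alpha> ?k 0 \<in> V"
        using element_image[OF k(1) \<open>0 \<in> V\<close>] by simp
      ultimately show ?thesis using iso[OF g c(1)] by simp
    qed
    then have "(\<lambda>x. (dist (\<alpha> g c) x)\<^sup>2) ` ?X \<subseteq> (\<lambda>x. (dist c x)\<^sup>2) ` ?X"
      using g by (fastforce simp: image_iff)
    then show "(SUP x\<in>?X. (dist (\<alpha> g c) x)\<^sup>2) \<le> (SUP x\<in>?X. (dist c x)\<^sup>2)"
      using \<open>?X \<noteq> {}\<close> bdd_above_dist_power2[OF bdd] by (intro cSup_subset_mono) auto
  qed
  then show ?thesis
    using c(1) by (auto simp: fixed_point_def)
qed

text \<open>Countably many group elements suffice to obstruct fixed points: choose \<open>g n\<close> moving the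
  origin by more than \<open>n\<close>. If all \<open>g n\<close> fixed a point \<open>v\<close>, they would keep the
  origin within distance \<open>norm v\<close> of \<open>v\<close>.\<close>

lemma no_fixed_point_witnesses:
  fixes \<alpha> :: "'g \<Rightarrow> 'v::real_inner \<Rightarrow> 'v"
  assumes "isometric_action G V \<alpha>" "\<not> (\<exists>v\<in>V. fixed_point G \<alpha> v)"
  obtains g :: "nat \<Rightarrow> 'g" where "range g \<subseteq> carrier G"
    "\<And>H v. \<lbrakk>range g \<subseteq> H; v \<in> V\<rbrakk> \<Longrightarrow> \<not> fixed_point (G\<lparr>carrier := H\<rparr>) \<alpha> v"
proof -
  have "\<not> bounded ((\<lambda>g. \<alpha> g 0) ` carrier G)"
    using bounded_orbit_imp_fixed_point assms by blast
  then have "\<exists>g\<in>carrier G. norm (\<alpha> g 0) > real n" for n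
    by (force simp: bounded_iff not_le)
  then obtain g where g: "\<And>n. g n \<in> carrier G" "\<And>n. norm (\<alpha> (g n) 0) > real n"
    by metis
  show thesis
  proof
    show "range g \<subseteq> carrier G" using g(1) by blast
    fix H v assume "range g \<subseteq> H" and v: "v \<in> V"
    show "\<not> fixed_point (G\<lparr>carrier := H\<rparr>) \<alpha> v"
    proof
      assume "fixed_point (G\<lparr>carrier := H\<rparr>) \<alpha> v"
      then have fixed: "\<alpha> (g n) v = v" for n
        using \<open>range g \<subseteq> H\<close> by (auto simp: fixed_point_def)
      have "0 \<in> V"
        using assms(1) subspace_0 by (auto simp: isometric_action_def hilbert_space_def)
      then have "dist (\<alpha> (g n) 0) v = norm v" for n
        using assms(1) g(1) v fixed[of n] unfolding isometric_action_def by (metis dist_0_norm)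
      then have "norm (\<alpha> (g n) 0) \<le> 2 * norm v" for n
        using norm_triangle_ineq2[of "\<alpha> (g n) 0" v] by (simp add: dist_norm)
      moreover obtain n :: nat where "2 * norm v \<le> real n"
        using real_arch_simple by blast
      ultimately show False using g(2)[of n] by (meson not_le order_trans)
    qed
  qed
qed

section \<open>Skolem hulls and density characters\<close>

lemma card_of_Times_le_infinite:
  assumes "infinite C" "|A| \<le>o |C|" "|B| \<le>o |C|"
  shows "|A \<times> B| \<le>o |C|"
  using card_of_Times_ordLeq_infinite_Field[OF _ assms(2,3) card_of_Card_order] assms(1)
  by (simp add: Field_card_of)

lemma card_of_Un_le_infinite:
  assumes "infinite C" "|A| \<le>o |C|" "|B| \<le>o |C|"
  shows "|A \<union> B| \<le>o |C|"
  using card_of_Un_ordLeq_infinite_Field[OF _ assms(2,3) card_of_Card_order] assms(1)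
  by (simp add: Field_card_of)

lemma card_of_lists_infinite:
  assumes "infinite A"
  shows "|lists A| \<le>o |A|"
proof -
  let ?L = "\<lambda>n. {xs \<in> lists A. length xs = n}"
  have "|?L n| \<le>o |A|" for n
  proof (induction n)
    case 0
    have "?L 0 = {[]}" by auto
    then show ?case
      using assms by (metis card_of_singl_ordLeq infinite_imp_nonempty)
  next
    case (Suc n)
    have "?L (Suc n) \<subseteq> (\<lambda>(x, xs). x # xs) ` (A \<times> ?L n)"
      by (force simp: length_Suc_conv image_iff)
    then have "|?L (Suc n)| \<le>o |A \<times> ?L n|"
      by (meson card_of_image card_of_mono1 ordLeq_transitive)
    moreover have "|A \<times> ?L n| \<le>o |A|"
      using card_of_Times_le_infinite[OF assms _ Suc.IH] card_of_mono1 by blast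
    ultimately show ?case
      using ordLeq_transitive by blast
  qed
  moreover have "lists A = (\<Union>n. ?L n)" by auto
  moreover have "|UNIV :: nat set| \<le>o |A|"
    using assms infinite_iff_card_of_nat by blast
  ultimately show ?thesis
    using assms card_of_UNION_ordLeq_infinite[of A UNIV ?L] by auto
qed

text \<open>The combinatorial part of the downward Loewenheim-Skolem theorem: countably many relations
  are witnessed inside a set of the same cardinality as the given infinite set. The relation
  \<open>P j\<close> takes its parameters as a list, so that a single index type covers relations of
  all arities.\<close>

lemma skolem_hull:
  fixes P :: "'j::countable \<Rightarrow> 'a list \<Rightarrow> 'a \<Rightarrow> bool"
  assumes "infinite A"
  obtains D where "A \<subseteq> D" "|D| \<le>o |A|"
    "\<And>j xs b. \<lbrakk>set xs \<subseteq> D; P j xs b\<rbrakk> \<Longrightarrow> \<exists>a\<in>D. P j xs a"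
proof -
  define next_layer where
    "next_layer X = X \<union> (\<lambda>(j, xs). SOME a. P j xs a) ` (UNIV \<times> lists X)" for X
  define layer where "layer n = (next_layer ^^ n) A" for n
  have layer_Suc: "layer (Suc n) = next_layer (layer n)" for n
    by (simp add: layer_def)
  have "incseq layer"
    by (rule incseq_SucI) (auto simp: layer_Suc next_layer_def)
  then have base: "A \<subseteq> layer n" for n
    using incseq_def[of layer] by (metis layer_def funpow_0 le0)
  have card_layer: "|layer n| \<le>o |A|" for n
  proof (induction n)
    case 0
    then show ?case using card_of_mono1[of A A] by (simp add: layer_def)
  next
    case (Suc n)
    have inf: "infinite (layer n)"
      using base assms infinite_super by blast
    have "|UNIV :: 'j set| \<le>o |UNIV :: nat set|"
      using card_of_ordLeq[of "UNIV :: 'j set" "UNIV :: nat set"] inj_to_nat by blast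
    then have "|UNIV :: 'j set| \<le>o |A|"
      using assms infinite_iff_card_of_nat ordLeq_transitive by blast
    moreover have "|lists (layer n)| \<le>o |A|"
      using card_of_lists_infinite[OF inf] Suc.IH ordLeq_transitive by blast
    ultimately have "|(UNIV :: 'j set) \<times> lists (layer n)| \<le>o |A|"
      using card_of_Times_le_infinite[OF assms] by blast
    then have "|(\<lambda>(j, xs). SOME a. P j xs a) ` (UNIV \<times> lists (layer n))| \<le>o |A|"
      using card_of_image ordLeq_transitive by blast
    then show ?case
      unfolding layer_Suc next_layer_def
      using card_of_Un_le_infinite[OF assms Suc.IH] by blast
  qed
  show thesis
  proof
    show "A \<subseteq> (\<Union>n. layer n)" using base by blast
    have "|UNIV :: nat set| \<le>o |A|"
      using assms infinite_iff_card_of_nat by blast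
    then show "|\<Union>n. layer n| \<le>o |A|"
      using assms card_layer card_of_UNION_ordLeq_infinite[of A UNIV layer] by blast
    fix j xs b
    assume xs: "set xs \<subseteq> (\<Union>n. layer n)" and b: "P j xs b"
    have "\<exists>n. set xs \<subseteq> layer n"
      using xs
    proof (induction xs)
      case (Cons x xs)
      then obtain n m where "x \<in> layer n" "set xs \<subseteq> layer m" by auto
      then have "set (x # xs) \<subseteq> layer (max n m)"
        using \<open>incseq layer\<close> unfolding incseq_def
        by (metis insert_subset list.simps(15) max.cobounded1 max.cobounded2 subset_iff)
      then show ?case by blast
    qed simp
    then obtain n where n: "set xs \<subseteq> layer n" by blast
    then have "(SOME a. P j xs a) \<in> layer (Suc n)"
      unfolding layer_Suc next_layer_def by (force simp: lists_eq_set)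
    moreover have "P j xs (SOME a. P j xs a)"
      using b by (rule someI)
    ultimately show "\<exists>a\<in>\<Union>n. layer n. P j xs a" by blast
  qed
qed

lemma in_closure_of_iff:
  assumes "Metric_space M d" "S \<subseteq> M"
  shows "x \<in> Metric_space.mtopology M d closure_of S \<longleftrightarrow>
    x \<in> M \<and> (\<forall>r>0. \<exists>y\<in>S. d x y < r)"
proof -
  interpret Metric_space M d by fact
  show ?thesis using assms(2) by (auto simp: metric_closure_of) blast
qed

text \<open>Metric spaces are Hausdorff, so a finite dense subset would be closed and thus everything.\<close>

lemma dense_subset_infinite:
  assumes "Metric_space M d" "S \<subseteq> M" "infinite S"
    "dense_subset (subtopology (Metric_space.mtopology M d) S) D"
  shows "infinite D"
proof
  interpret Metric_space M d by fact
  assume "finite D"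
  have "D \<subseteq> S" using assms(2,4) by (auto simp: dense_subset_def)
  then have "closedin mtopology D"
    using \<open>finite D\<close> assms(2) Hausdorff_space_mtopology
    by (metis closedin_Hausdorff_finite order_trans topspace_mtopology)
  then have "closedin (subtopology mtopology S) D"
    using \<open>D \<subseteq> S\<close> closedin_subset_topspace by blast
  then show False
    using assms \<open>finite D\<close> \<open>D \<subseteq> S\<close>
    by (auto simp: dense_subset_def closure_of_closedin Int_absorb1)
qed

lemma dense_subsetD:
  assumes "Metric_space M d" "S \<subseteq> M"
    "dense_subset (subtopology (Metric_space.mtopology M d) S) D" "x \<in> S" "r > 0"
  shows "\<exists>y\<in>D. d x y < r"
proof -
  interpret Metric_space M d by fact
  have "x \<in> mtopology closure_of (S \<inter> D)"
    using assms by (auto simp: dense_subset_def closure_of_subtopology)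
  then show ?thesis
    using assms in_closure_of_iff[OF assms(1), of "S \<inter> D" x] by blast
qed

lemma dense_subsetI:
  assumes "Metric_space M d" "S \<subseteq> M" "D \<subseteq> S"
    "\<And>x r. \<lbrakk>x \<in> S; r > 0\<rbrakk> \<Longrightarrow> \<exists>y\<in>D. d x y < r"
  shows "dense_subset (subtopology (Metric_space.mtopology M d) S) D"
proof -
  interpret Metric_space M d by fact
  have "S \<subseteq> mtopology closure_of D"
    using assms in_closure_of_iff[OF assms(1), of D] by blast
  then show ?thesis
    using assms(2,3) by (auto simp: dense_subset_def closure_of_subtopology Int_absorb1)
qed

text \<open>From a dense subset \<open>E\<close> of \<open>T\<close> one obtains a dense subset of \<open>S\<close> by selecting, for each
  point of \<open>E\<close> and each \<open>n\<close>, a point of \<open>S\<close> at distance less than \<open>1 / (n + 1)\<close> if there is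
  one. As \<open>E\<close> is infinite, this does not increase the cardinality.\<close>

lemma density_character_mono:
  assumes "Metric_space M d" "S \<subseteq> T" "T \<subseteq> M" "infinite S"
  shows "density_character (subtopology (Metric_space.mtopology M d) S)
    \<le>o density_character (subtopology (Metric_space.mtopology M d) T)"
proof -
  interpret Metric_space M d by fact
  obtain E where E: "dense_subset (subtopology mtopology T) E"
      and cardE: "density_character (subtopology mtopology T) = |E|"
    using density_character_least by blast
  have "infinite T" using assms infinite_super by blast
  then have "infinite E" using dense_subset_infinite assms(1,3) E by blast
  define near where
    "near = (\<lambda>(y, n). if \<exists>x\<in>S. d x y < inverse (real (Suc n))
       then SOME x. x \<in> S \<and> d x y < inverse (real (Suc n)) else SOME x. x \<in> S)"
  let ?E' = "near ` (E \<times> UNIV)"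
  have "S \<noteq> {}" using assms(4) by auto
  have near: "near (y, n) \<in> S" "\<exists>x\<in>S. d x y < inverse (real (Suc n)) \<Longrightarrow>
      d (near (y, n)) y < inverse (real (Suc n))" for y n
  proof -
    have "(SOME x. x \<in> S) \<in> S"
      using \<open>S \<noteq> {}\<close> by (simp add: some_in_eq)
    moreover have "(SOME x. x \<in> S \<and> d x y < inverse (real (Suc n))) \<in> S \<and>
       d (SOME x. x \<in> S \<and> d x y < inverse (real (Suc n))) y < inverse (real (Suc n))"
      if "\<exists>x\<in>S. d x y < inverse (real (Suc n))"
      using that someI_ex[of "\<lambda>x. x \<in> S \<and> d x y < inverse (real (Suc n))"] by blast
    ultimately show "near (y, n) \<in> S" "\<exists>x\<in>S. d x y < inverse (real (Suc n)) \<Longrightarrow>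
      d (near (y, n)) y < inverse (real (Suc n))"
      by (auto simp: near_def)
  qed
  have "dense_subset (subtopology mtopology S) ?E'"
  proof (rule dense_subsetI[OF assms(1)])
    show "S \<subseteq> M" using assms by blast
    show "?E' \<subseteq> S" using near(1) by auto
    fix x and r :: real
    assume x: "x \<in> S" and r: "r > 0"
    obtain n where n: "inverse (real (Suc n)) < r / 2"
      using r reals_Archimedean[of "r / 2"] by auto
    have "x \<in> T" using x assms by blast
    then obtain y where y: "y \<in> E" "d x y < inverse (real (Suc n))"
      using dense_subsetD[OF assms(1,3) E, of x "inverse (real (Suc n))"] by auto
    have "y \<in> M"
      using y(1) E assms(3) by (auto simp: dense_subset_def)
    then have "d x (near (y, n)) \<le> d x y + d (near (y, n)) y"
      by (metis assms(2,3) commute near(1) subsetD triangle x)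
    also have "\<dots> < r"
      using near(2)[of y n] x y(2) n by force
    finally show "\<exists>z\<in>?E'. d x z < r"
      using y(1) by blast
  qed
  then have "density_character (subtopology mtopology S) \<le>o |?E'|"
    using density_character_least[of "subtopology mtopology S"] by auto
  moreover have "|?E'| \<le>o |E \<times> (UNIV :: nat set)|"
    by (rule card_of_image)
  moreover have "|E \<times> (UNIV :: nat set)| \<le>o |E|"
    using card_of_Times_le_infinite[OF \<open>infinite E\<close>] \<open>infinite E\<close> infinite_iff_card_of_nat
      card_of_mono1 by blast
  ultimately show ?thesis
    unfolding cardE using ordLeq_transitive[OF ordLeq_transitive] by blast
qed

section \<open>Approximation of continuous connectives by step functions\<close>

text \<open>A continuous function on \<open>\<real>\<^sup>k\<close> is uniformly continuous on a cube. To use the metric of the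
  countable product of copies of \<open>\<real>\<close>, the cube is embedded by padding with zeros.\<close>

lemma connective_uniformly_continuous:
  fixes u :: "(nat \<Rightarrow> real) \<Rightarrow> real"
  assumes u: "continuous_map (powertop_real {..<k}) euclideanreal u" and "\<epsilon> > 0"
  obtains \<delta> where "\<delta> > 0"
    "\<And>x y. \<lbrakk>\<And>i. i < k \<Longrightarrow> \<bar>x i\<bar> \<le> M; \<And>i. i < k \<Longrightarrow> \<bar>y i\<bar> \<le> M;
      \<And>i. i < k \<Longrightarrow> \<bar>x i - y i\<bar> < \<delta>\<rbrakk>
      \<Longrightarrow> \<bar>u (restrict x {..<k}) - u (restrict y {..<k})\<bar> < \<epsilon>"
proof -
  let ?u = "\<lambda>x :: nat \<Rightarrow> real. u (restrict x {..<k})"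
  let ?box = "PiE UNIV (\<lambda>i. if i < k then {-M..M} else {0 :: real})"
  have "continuous_map (powertop_real UNIV) (powertop_real {..<k}) (\<lambda>x. restrict x {..<k})"
    by (auto simp: continuous_map_componentwise intro: continuous_map_product_projection)
  then have "continuous_map (powertop_real UNIV) euclideanreal ?u"
    using continuous_map_compose[OF _ u] by (simp add: o_def)
  then have "continuous_on ?box ?u"
    using continuous_on_subset[of UNIV]
    by (simp add: euclidean_product_topology continuous_map_iff_continuous2)
  moreover have "compact ?box"
  proof -
    have "compactin (powertop_real UNIV) ?box"
      by (subst compactin_PiE) auto
    then show ?thesis by (simp add: euclidean_product_topology)
  qed
  ultimately have "uniformly_continuous_on ?box ?u"
    by (rule compact_uniformly_continuous)
  then obtain \<eta> where "\<eta> > 0" and \<eta>: "\<And>x y. \<lbrakk>x \<in> ?box; y \<in> ?box; dist y x < \<eta>\<rbrakk>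
      \<Longrightarrow> dist (?u y) (?u x) < \<epsilon>"
    using \<open>\<epsilon> > 0\<close> unfolding uniformly_continuous_on_def by blast
  obtain N where N: "(1/2) ^ N < \<eta> / 2"
    using \<open>\<eta> > 0\<close> real_arch_pow_inv[of "\<eta> / 2" "1/2"] by auto
  show thesis
  proof
    \<comment> \<open>The metric of the product is at most twice the distance of finitely many coordinates plus a tail.\<close>
    show "\<eta> / 4 > 0" using \<open>\<eta> > 0\<close> by simp
    fix x y :: "nat \<Rightarrow> real"
    assume x: "\<And>i. i < k \<Longrightarrow> \<bar>x i\<bar> \<le> M" and y: "\<And>i. i < k \<Longrightarrow> \<bar>y i\<bar> \<le> M"
      and xy: "\<And>i. i < k \<Longrightarrow> \<bar>x i - y i\<bar> < \<eta> / 4"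
    define x' where "x' i = (if i < k then x i else 0)" for i
    define y' where "y' i = (if i < k then y i else 0)" for i
    have box: "x' \<in> ?box" "y' \<in> ?box"
      using x y by (auto simp: x'_def y'_def abs_le_iff minus_le_iff)
    have "dist (x' i) (y' i) < \<eta> / 4" for i
      using xy \<open>\<eta> > 0\<close> by (auto simp: x'_def y'_def dist_real_def)
    moreover have "finite {dist (x' (from_nat n)) (y' (from_nat n)) |n. n \<le> N}"
      by (rule finite_image_set) simp
    ultimately have "Max {dist (x' (from_nat n)) (y' (from_nat n)) |n. n \<le> N} < \<eta> / 4"
      by (subst Max_less_iff) auto
    then have "dist x' y' < \<eta>"
      using dist_fun_le_dist_first_terms[of x' y' N] N by linarith
    then have "dist (?u x') (?u y') < \<epsilon>"
      using \<eta> box by blast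
    moreover have "restrict x' {..<k} = restrict x {..<k}" "restrict y' {..<k} = restrict y {..<k}"
      by (auto simp: x'_def y'_def)
    ultimately show "\<bar>?u x - ?u y\<bar> < \<epsilon>"
      by (simp add: dist_real_def)
  qed
qed

text \<open>A step function with rational values on cells of side \<open>1 / N\<close>. The table \<open>T\<close> assigns to
  a list \<open>l\<close> of integers the value on the cell with lower corner \<open>l ! i / N\<close>, \<open>i < k\<close>. There are only countably many such
  functions, which is their purpose.\<close>

definition step_connective :: "nat \<Rightarrow> nat \<Rightarrow> (int list \<times> rat) list \<Rightarrow> (nat \<Rightarrow> real) \<Rightarrow> real" where
  "step_connective k N T x =
     (case map_of T (map (\<lambda>i. \<lfloor>real N * x i\<rfloor>) [0..<k]) of None \<Rightarrow> 0 | Some q \<Rightarrow> of_rat q)"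

text \<open>Only finitely many cells meet the cube. Each gets a rational value close to that of \<open>u\<close> at a
  sample point of the cell in the cube; uniform continuity extends the estimate to the whole cell.\<close>

lemma step_connective_approximates:
  fixes u :: "(nat \<Rightarrow> real) \<Rightarrow> real"
  assumes u: "continuous_map (powertop_real {..<k}) euclideanreal u" and "\<epsilon> > 0"
  obtains N T where "\<And>x. (\<And>i. i < k \<Longrightarrow> \<bar>x i\<bar> \<le> M) \<Longrightarrow>
      \<bar>step_connective k N T x - u (restrict x {..<k})\<bar> < \<epsilon>"
proof -
  obtain \<delta> where "\<delta> > 0" and \<delta>: "\<And>x y. \<lbrakk>\<And>i. i < k \<Longrightarrow> \<bar>x i\<bar> \<le> M; \<And>i. i < k \<Longrightarrow> \<bar>y i\<bar> \<le> M;
      \<And>i. i < k \<Longrightarrow> \<bar>x i - y i\<bar> < \<delta>\<rbrakk>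
      \<Longrightarrow> \<bar>u (restrict x {..<k}) - u (restrict y {..<k})\<bar> < \<epsilon> / 2"
    using connective_uniformly_continuous[OF u, of "\<epsilon> / 2" M] \<open>\<epsilon> > 0\<close> by (metis half_gt_zero)
  obtain N where N: "N > 0" "inverse (real N) < \<delta>"
    using ex_inverse_of_nat_less[OF \<open>\<delta> > 0\<close>] by blast
  define cell where "cell x = map (\<lambda>i. \<lfloor>real N * x i\<rfloor>) [0..<k]" for x
  let ?I = "{\<lfloor>- (real N * M)\<rfloor>..\<lfloor>real N * M\<rfloor>}"
  define Box where "Box = {x. \<forall>i<k. \<bar>x i\<bar> \<le> M}"
  have "cell ` Box \<subseteq> {l. set l \<subseteq> ?I \<and> length l = k}"
  proof clarify
    fix x assume "x \<in> Box"
    then have "- (real N * M) \<le> real N * x i \<and> real N * x i \<le> real N * M" if "i < k" for i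
      using that N(1) mult_left_mono[of "-M" "x i" "real N"] mult_left_mono[of "x i" M "real N"]
      by (auto simp: Box_def abs_le_iff)
    then show "set (cell x) \<subseteq> ?I \<and> length (cell x) = k"
      by (auto simp: cell_def intro!: floor_mono)
  qed
  then have "finite (cell ` Box)"
    using finite_lists_length_eq[of ?I k] finite_subset by auto
  then obtain ls where ls: "set ls = cell ` Box"
    using finite_list by blast
  define rep where "rep l = (SOME x. x \<in> Box \<and> cell x = l)" for l
  have rep: "rep l \<in> Box" "cell (rep l) = l" if "l \<in> cell ` Box" for l
    using that someI_ex[of "\<lambda>x. x \<in> Box \<and> cell x = l"] by (auto simp: rep_def)
  have "\<exists>q. \<bar>real_of_rat q - u (restrict (rep l) {..<k})\<bar> < \<epsilon> / 2" for l
  proof -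
    obtain q where "u (restrict (rep l) {..<k}) - \<epsilon> / 2 < real_of_rat q"
        "real_of_rat q < u (restrict (rep l) {..<k}) + \<epsilon> / 2"
      using of_rat_dense[of "u (restrict (rep l) {..<k}) - \<epsilon> / 2" "u (restrict (rep l) {..<k}) + \<epsilon> / 2"]
        \<open>\<epsilon> > 0\<close> by auto
    then show ?thesis by (intro exI[of _ q]) linarith
  qed
  then obtain q where q: "\<And>l. \<bar>real_of_rat (q l) - u (restrict (rep l) {..<k})\<bar> < \<epsilon> / 2"
    by metis
  show thesis
  proof
    fix x assume x: "\<And>i. i < k \<Longrightarrow> \<bar>x i\<bar> \<le> M"
    let ?y = "rep (cell x)"
    have cx: "cell x \<in> cell ` Box"
      using x by (auto simp: Box_def)
    note y = rep[OF cx]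
    have "step_connective k N (map (\<lambda>l. (l, q l)) ls) x = of_rat (q (cell x))"
      using cx ls by (simp add: step_connective_def map_of_map_restrict flip: cell_def)
    moreover have "\<bar>u (restrict x {..<k}) - u (restrict ?y {..<k})\<bar> < \<epsilon> / 2"
    proof (rule \<delta>)
      show "\<bar>x i\<bar> \<le> M" "\<bar>?y i\<bar> \<le> M" if "i < k" for i
        using x y(1) that by (auto simp: Box_def)
      show "\<bar>x i - ?y i\<bar> < \<delta>" if "i < k" for i
      proof -
        have "\<lfloor>real N * x i\<rfloor> = \<lfloor>real N * ?y i\<rfloor>"
          using y(2) that unfolding cell_def by (simp add: list_eq_iff_nth_eq)
        then have "\<bar>real N * x i - real N * ?y i\<bar> < 1"
          by linarith
        then have "real N * \<bar>x i - ?y i\<bar> < 1"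
          by (simp add: abs_mult flip: right_diff_distrib)
        then have "\<bar>x i - ?y i\<bar> < inverse (real N)"
          using N(1) by (simp add: field_simps)
        then show ?thesis using N(2) by linarith
      qed
    qed
    ultimately show "\<bar>step_connective k N (map (\<lambda>l. (l, q l)) ls) x - u (restrict x {..<k})\<bar> < \<epsilon>"
      using q[of "cell x"] by linarith
  qed
qed

lemma step_connective_cong:
  assumes "\<And>i. i < k \<Longrightarrow> x i = y i"
  shows "step_connective k N T x = step_connective k N T y"
proof -
  have "map (\<lambda>i. \<lfloor>real N * x i\<rfloor>) [0..<k] = map (\<lambda>i. \<lfloor>real N * y i\<rfloor>) [0..<k]"
    using assms by auto
  then show ?thesis by (simp only: step_connective_def)
qed

instance gterm :: countable by countable_datatype

text \<open>Codes for the formulas whose connectives are step functions; unlike the formulas of the full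
  language, they form a countable set.\<close>

datatype formula_code =
    CDist gterm gterm
  | CConn nat "(int list \<times> rat) list" "formula_code list"
  | CSup nat nat formula_code
  | CInf nat nat formula_code

instance formula_code :: countable by countable_datatype

primrec decode :: "formula_code \<Rightarrow> cformula" where
  "decode (CDist s t) = Dist s t"
| "decode (CConn N T cs) = Conn (step_connective (length cs) N T) (map decode cs)"
| "decode (CSup n i c) = QSup n i (decode c)"
| "decode (CInf n i c) = QInf n i (decode c)"

section \<open>Boundedness and uniform continuity of formulas\<close>

lemma finite_term_vars: "finite (term_vars t)"
  by (induction t) auto

lemma finite_free_vars: "finite (free_vars \<phi>)"
  by (induction \<phi> rule: free_vars.induct) (auto simp: finite_term_vars)

lemma free_vars_nth: "i < length \<phi>s \<Longrightarrow> free_vars (\<phi>s ! i) \<subseteq> free_vars (Conn u \<phi>s)"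
  using UN_upper[OF nth_mem, of i \<phi>s free_vars] by (simp only: free_vars.simps)

lemma term_val_cong:
  "(\<And>x. x \<in> term_vars t \<Longrightarrow> e x = e' x) \<Longrightarrow> term_val G e t = term_val G e' t"
  by (induction t) auto

lemma formula_val_cong:
  "(\<And>x. x \<in> free_vars \<phi> \<Longrightarrow> e x = e' x) \<Longrightarrow> formula_val G d K e \<phi> = formula_val G d K e' \<phi>"
proof (induction \<phi> arbitrary: e e' rule: free_vars.induct)
  case (1 s t)
  then show ?case
    using term_val_cong[of s e e' G] term_val_cong[of t e e' G] by simp
next
  case (2 u \<phi>s)
  have "map (formula_val G d K e) \<phi>s = map (formula_val G d K e') \<phi>s"
  proof (rule map_cong[OF refl])
    fix \<psi> assume "\<psi> \<in> set \<phi>s"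
    with 2(2) show "formula_val G d K e \<psi> = formula_val G d K e' \<psi>"
      by (intro 2(1)) auto
  qed
  then show ?case by (simp only: formula_val.simps)
next
  case (3 n i \<phi>)
  have "formula_val G d K (e((n, i) := a)) \<phi> = formula_val G d K (e'((n, i) := a)) \<phi>" for a
    using 3(2) by (intro 3(1)) auto
  then show ?case by simp
next
  case (4 n i \<phi>)
  have "formula_val G d K (e((n, i) := a)) \<phi> = formula_val G d K (e'((n, i) := a)) \<phi>" for a
    using 4(2) by (intro 4(1)) auto
  then show ?case by simp
qed

text \<open>The set \<open>A\<close> may be empty, because the sort \<open>K 0\<close> may be; both suprema are then the same
  default value.\<close>

lemma cSUP_abs_diff_le:
  fixes f g :: "'a \<Rightarrow> real"
  assumes "\<epsilon> \<ge> 0" "\<And>a. a \<in> A \<Longrightarrow> \<bar>f a\<bar> \<le> M" "\<And>a. a \<in> A \<Longrightarrow> \<bar>f a - g a\<bar> \<le> \<epsilon>"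
  shows "\<bar>(SUP a\<in>A. f a) - (SUP a\<in>A. g a)\<bar> \<le> \<epsilon>"
proof (cases "A = {}")
  case True
  then show ?thesis using assms(1) by simp
next
  case False
  have bdd: "bdd_above (f ` A)" "bdd_above (g ` A)"
    using assms(2,3)
    by (force intro!: bdd_aboveI2[of _ _ M], force intro!: bdd_aboveI2[of _ _ "M + \<epsilon>"])
  have "f a \<le> (SUP a\<in>A. g a) + \<epsilon>" "g a \<le> (SUP a\<in>A. f a) + \<epsilon>" if "a \<in> A" for a
    using cSUP_upper[OF that bdd(1)] cSUP_upper[OF that bdd(2)] assms(3)[OF that] by linarith+
  then have "(SUP a\<in>A. f a) \<le> (SUP a\<in>A. g a) + \<epsilon>" "(SUP a\<in>A. g a) \<le> (SUP a\<in>A. f a) + \<epsilon>"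
    using False by (auto intro: cSUP_least)
  then show ?thesis by linarith
qed

lemma cINF_eq_uminus_cSUP: "(INF a\<in>A. f a) = - (SUP a\<in>A. - f a :: real)"
  by (simp add: Inf_real_def image_image)

lemma cINF_abs_diff_le:
  fixes f g :: "'a \<Rightarrow> real"
  assumes "\<epsilon> \<ge> 0" "\<And>a. a \<in> A \<Longrightarrow> \<bar>f a\<bar> \<le> M" "\<And>a. a \<in> A \<Longrightarrow> \<bar>f a - g a\<bar> \<le> \<epsilon>"
  shows "\<bar>(INF a\<in>A. f a) - (INF a\<in>A. g a)\<bar> \<le> \<epsilon>"
proof -
  have "\<bar>(SUP a\<in>A. - f a) - (SUP a\<in>A. - g a)\<bar> \<le> \<epsilon>"
  proof (rule cSUP_abs_diff_le[OF assms(1), of _ _ M])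
    show "\<bar>- f a\<bar> \<le> M" "\<bar>- f a - - g a\<bar> \<le> \<epsilon>" if "a \<in> A" for a
      using assms(2,3)[OF that] by linarith+
  qed
  then show ?thesis
    unfolding cINF_eq_uminus_cSUP by linarith
qed

lemma cSUP_dense_subset_eq:
  fixes f :: "'a \<Rightarrow> real"
  assumes "B \<subseteq> A" "\<And>a. a \<in> A \<Longrightarrow> \<bar>f a\<bar> \<le> M"
    "\<And>a \<epsilon>. \<lbrakk>a \<in> A; \<epsilon> > 0\<rbrakk> \<Longrightarrow> \<exists>b\<in>B. \<bar>f b - f a\<bar> < \<epsilon>"
  shows "(SUP b\<in>B. f b) = (SUP a\<in>A. f a)"
proof (cases "A = {}")
  case True
  then show ?thesis using assms(1) by simp
next
  case False
  then have "B \<noteq> {}" using assms(3)[of _ 1] by fastforce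
  have bdd: "bdd_above (f ` A)" using assms(2) by (force intro!: bdd_aboveI2[of _ _ M])
  then have bddB: "bdd_above (f ` B)" using assms(1) by (meson bdd_above_mono image_mono)
  show ?thesis
  proof (rule antisym)
    show "(SUP b\<in>B. f b) \<le> (SUP a\<in>A. f a)"
      using \<open>B \<noteq> {}\<close> bdd assms(1) by (intro cSUP_subset_mono) auto
    have "f a \<le> (SUP b\<in>B. f b)" if "a \<in> A" for a
    proof (rule field_le_epsilon)
      fix \<epsilon> :: real assume "\<epsilon> > 0"
      then obtain b where "b \<in> B" "\<bar>f b - f a\<bar> < \<epsilon>" using assms(3)[OF \<open>a \<in> A\<close>] by blast
      then show "f a \<le> (SUP b\<in>B. f b) + \<epsilon>"
        using cSUP_upper[OF \<open>b \<in> B\<close> bddB] by linarith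
    qed
    then show "(SUP a\<in>A. f a) \<le> (SUP b\<in>B. f b)"
      using False by (intro cSUP_least)
  qed
qed

lemma cINF_dense_subset_eq:
  fixes f :: "'a \<Rightarrow> real"
  assumes "B \<subseteq> A" "\<And>a. a \<in> A \<Longrightarrow> \<bar>f a\<bar> \<le> M"
    "\<And>a \<epsilon>. \<lbrakk>a \<in> A; \<epsilon> > 0\<rbrakk> \<Longrightarrow> \<exists>b\<in>B. \<bar>f b - f a\<bar> < \<epsilon>"
  shows "(INF b\<in>B. f b) = (INF a\<in>A. f a)"
proof -
  have "(SUP b\<in>B. - f b) = (SUP a\<in>A. - f a)"
  proof (rule cSUP_dense_subset_eq[OF assms(1), of _ M])
    show "\<bar>- f a\<bar> \<le> M" if "a \<in> A" for a
      using assms(2)[OF that] by simp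
    show "\<exists>b\<in>B. \<bar>- f b - - f a\<bar> < \<epsilon>" if aE: "a \<in> A" "\<epsilon> > 0" for a \<epsilon>
    proof -
      obtain b where "b \<in> B" "\<bar>f b - f a\<bar> < \<epsilon>"
        using assms(3)[OF aE] by blast
      then show ?thesis by (intro bexI[of _ b]) linarith+
    qed
  qed
  then show ?thesis
    by (simp only: cINF_eq_uminus_cSUP)
qed

lemma has_modulusD:
  "\<lbrakk>has_modulus \<gamma> A dA dB f; \<epsilon> > 0; x \<in> A; y \<in> A; dA x y < \<gamma> \<epsilon>\<rbrakk> \<Longrightarrow> dB (f x) (f y) < \<epsilon>"
  by (simp add: has_modulus_def)

lemma finite_uniform_bound:
  fixes f :: "'a \<Rightarrow> 'b \<Rightarrow> real"
  assumes "finite S" "\<And>x. x \<in> S \<Longrightarrow> \<exists>M. \<forall>y. P x y \<longrightarrow> \<bar>f x y\<bar> \<le> M"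
  shows "\<exists>M. \<forall>x\<in>S. \<forall>y. P x y \<longrightarrow> \<bar>f x y\<bar> \<le> M"
proof -
  obtain B where B: "\<And>x y. \<lbrakk>x \<in> S; P x y\<rbrakk> \<Longrightarrow> \<bar>f x y\<bar> \<le> B x"
    using assms(2) by metis
  have "B x \<le> (\<Sum>x\<in>S. \<bar>B x\<bar>)" if "x \<in> S" for x
    using member_le_sum[OF that, of "\<lambda>x. \<bar>B x\<bar>"] assms(1) by auto
  then have "\<bar>f x y\<bar> \<le> (\<Sum>x\<in>S. \<bar>B x\<bar>)" if "x \<in> S" "P x y" for x y
    using B[OF that] that(1) order_trans by blast
  then show ?thesis by blast
qed

context metric_group_presentation
begin

text \<open>Only the variables in \<open>X\<close> are required to take values in their sorts: assignments that
  respect all sorts at once do not exist if \<open>K 0\<close> is empty.\<close>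

definition admissible :: "(nat \<times> nat \<Rightarrow> 'g) \<Rightarrow> (nat \<times> nat) set \<Rightarrow> bool" where
  "admissible e X \<longleftrightarrow> (\<forall>x\<in>X. e x \<in> K (fst x))"

lemma K_subset_carrier: "K n \<subseteq> carrier G"
  using carrier_eq by blast

lemma dist_self_K: "a \<in> K n \<Longrightarrow> d a a = 0"
  using subsetD[OF K_subset_carrier] by (simp add: mdist_zero)

lemma admissible_subset: "admissible e X \<Longrightarrow> Y \<subseteq> X \<Longrightarrow> admissible e Y"
  by (auto simp: admissible_def)

lemma admissible_Un [simp]: "admissible e (X \<union> Y) \<longleftrightarrow> admissible e X \<and> admissible e Y"
  by (auto simp: admissible_def)

lemma admissible_update:
  "admissible e (X - {(n, i)}) \<Longrightarrow> a \<in> K n \<Longrightarrow> admissible (e((n, i) := a)) X"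
  by (auto simp: admissible_def)

lemma term_val_in_K:
  "has_sort t n \<Longrightarrow> admissible e (term_vars t) \<Longrightarrow> term_val G e t \<in> K n"
  by (induction rule: has_sort.induct)
    (auto simp: admissible_def one_in_K mult_in_K inv_in_K)

lemma term_uniformly_continuous:
  assumes "has_sort t n" "\<epsilon> > 0"
  shows "\<exists>\<delta>>0. \<forall>e e'. admissible e (term_vars t) \<longrightarrow> admissible e' (term_vars t) \<longrightarrow>
    (\<forall>x\<in>term_vars t. d (e x) (e' x) < \<delta>) \<longrightarrow> d (term_val G e t) (term_val G e' t) < \<epsilon>"
  using assms
proof (induction arbitrary: \<epsilon> rule: has_sort.induct)
  case (1 n i)
  then show ?case by auto
next
  case (2 n)
  then show ?case by auto
next
  case (3 s n t)
  let ?\<gamma> = "\<gamma>m n (\<epsilon> / 2)"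
  have "?\<gamma> > 0" using modulus_\<gamma>m 3(5) by (simp add: modulus_def)
  obtain \<delta>s where \<delta>s: "\<delta>s > 0" "\<And>e e'. \<lbrakk>admissible e (term_vars s); admissible e' (term_vars s);
      \<forall>x\<in>term_vars s. d (e x) (e' x) < \<delta>s\<rbrakk> \<Longrightarrow> d (term_val G e s) (term_val G e' s) < ?\<gamma>"
    using 3(3)[OF \<open>?\<gamma> > 0\<close>] by blast
  obtain \<delta>t where \<delta>t: "\<delta>t > 0" "\<And>e e'. \<lbrakk>admissible e (term_vars t); admissible e' (term_vars t);
      \<forall>x\<in>term_vars t. d (e x) (e' x) < \<delta>t\<rbrakk> \<Longrightarrow> d (term_val G e t) (term_val G e' t) < ?\<gamma>"
    using 3(4)[OF \<open>?\<gamma> > 0\<close>] by blast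
  show ?case
  proof (intro exI[of _ "min \<delta>s \<delta>t"] conjI allI impI)
    show "min \<delta>s \<delta>t > 0" using \<delta>s \<delta>t by simp
    fix e e' assume e: "admissible e (term_vars (Mult s t))" "admissible e' (term_vars (Mult s t))"
      and close: "\<forall>x\<in>term_vars (Mult s t). d (e x) (e' x) < min \<delta>s \<delta>t"
    have adm: "admissible e (term_vars s)" "admissible e' (term_vars s)"
      "admissible e (term_vars t)" "admissible e' (term_vars t)"
      using e by auto
    let ?a = "term_val G e s" and ?a' = "term_val G e' s"
    let ?b = "term_val G e t" and ?b' = "term_val G e' t"
    have in_K: "?a \<in> K n" "?a' \<in> K n" "?b \<in> K n" "?b' \<in> K n"
      using adm 3(1,2) term_val_in_K by blast+
    have "d ?a ?a' < ?\<gamma>" "d ?b ?b' < ?\<gamma>"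
      using \<delta>s(2)[OF adm(1,2)] \<delta>t(2)[OF adm(3,4)] close by auto
    moreover have mod: "has_modulus (\<gamma>m n) (K n) d d (\<lambda>x. x \<otimes> ?b)"
      "has_modulus (\<gamma>m n) (K n) d d (\<lambda>y. ?a' \<otimes> y)"
      using mult_modulus[of n] in_K unfolding has_modulus2_def by blast+
    ultimately have "d (?a \<otimes> ?b) (?a' \<otimes> ?b) < \<epsilon> / 2" "d (?a' \<otimes> ?b) (?a' \<otimes> ?b') < \<epsilon> / 2"
      using has_modulusD[OF mod(1) half_gt_zero[OF 3(5)] in_K(1,2)]
        has_modulusD[OF mod(2) half_gt_zero[OF 3(5)] in_K(3,4)] by auto
    moreover have "d (?a \<otimes> ?b) (?a' \<otimes> ?b') \<le> d (?a \<otimes> ?b) (?a' \<otimes> ?b) + d (?a' \<otimes> ?b) (?a' \<otimes> ?b')"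
      using in_K K_subset_carrier by (intro triangle) blast+
    ultimately show "d (term_val G e (Mult s t)) (term_val G e' (Mult s t)) < \<epsilon>"
      by simp
  qed
next
  case (4 t n)
  have "\<gamma>i n \<epsilon> > 0" using modulus_\<gamma>i 4(3) by (simp add: modulus_def)
  then obtain \<delta> where \<delta>: "\<delta> > 0" "\<And>e e'. \<lbrakk>admissible e (term_vars t); admissible e' (term_vars t);
      \<forall>x\<in>term_vars t. d (e x) (e' x) < \<delta>\<rbrakk> \<Longrightarrow> d (term_val G e t) (term_val G e' t) < \<gamma>i n \<epsilon>"
    using 4(2) by blast
  have "d (inv (term_val G e t)) (inv (term_val G e' t)) < \<epsilon>"
    if "admissible e (term_vars t)" "admissible e' (term_vars t)"
      "\<forall>x\<in>term_vars t. d (e x) (e' x) < \<delta>" for e e'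
    using inv_modulus[of n] \<delta>(2)[OF that] term_val_in_K[OF 4(1)] that 4(3)
    unfolding has_modulus_def by blast
  then show ?case using \<delta>(1) by auto
qed

text \<open>Distances are bounded because the sorts are, and a continuous connective maps the cube
  containing the values of its arguments to a compact set.\<close>

lemma formula_bounded:
  "well_formed \<phi> \<Longrightarrow> \<exists>M. \<forall>e. admissible e (free_vars \<phi>) \<longrightarrow> \<bar>formula_val G d K e \<phi>\<bar> \<le> M"
proof (induction \<phi> rule: well_formed.induct)
  case (1 s t)
  then obtain n where n: "has_sort s n" "has_sort t n" by auto
  obtain B where B: "\<And>x y. \<lbrakk>x \<in> K n; y \<in> K n\<rbrakk> \<Longrightarrow> d x y \<le> B"
    using bounded_K[of n] unfolding mbounded_alt by blast
  have "\<bar>formula_val G d K e (Dist s t)\<bar> \<le> B" if "admissible e (free_vars (Dist s t))" for e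
    using that B(1)[OF term_val_in_K[OF n(1)] term_val_in_K[OF n(2)], of e e] 
    by auto
  then show ?case by blast
next
  case (2 u \<phi>s)
  have "\<exists>M. \<forall>\<phi>\<in>set \<phi>s. \<forall>e. admissible e (free_vars \<phi>) \<longrightarrow> \<bar>formula_val G d K e \<phi>\<bar> \<le> M"
    using 2 by (auto intro!: finite_uniform_bound[OF finite_set])
  then obtain M where M: "\<And>\<phi> e. \<lbrakk>\<phi> \<in> set \<phi>s; admissible e (free_vars \<phi>)\<rbrakk>
      \<Longrightarrow> \<bar>formula_val G d K e \<phi>\<bar> \<le> M"
    by blast
  have "continuous_map (powertop_real {..<length \<phi>s}) euclideanreal u"
    using 2(2) by simp
  moreover have "compactin (powertop_real {..<length \<phi>s}) (PiE {..<length \<phi>s} (\<lambda>_. {-M..M}))"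
    by (simp add: compactin_PiE)
  ultimately have "compactin euclideanreal (u ` (PiE {..<length \<phi>s} (\<lambda>_. {-M..M})))"
    by (rule image_compactin[rotated])
  then have "bounded (u ` (PiE {..<length \<phi>s} (\<lambda>_. {-M..M})))"
    using compact_imp_bounded by simp
  then obtain M' where M': "\<And>x. x \<in> PiE {..<length \<phi>s} (\<lambda>_. {-M..M}) \<Longrightarrow> \<bar>u x\<bar> \<le> M'"
    unfolding bounded_real by auto
  have "\<bar>formula_val G d K e (Conn u \<phi>s)\<bar> \<le> \<bar>M'\<bar>"
    if "admissible e (free_vars (Conn u \<phi>s))" for e
  proof -
    have "(\<lambda>i\<in>{..<length \<phi>s}. map (formula_val G d K e) \<phi>s ! i) \<in> PiE {..<length \<phi>s} (\<lambda>_. {-M..M})"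
    proof (rule restrict_PiE_iff[THEN iffD2], rule ballI)
      fix i assume "i \<in> {..<length \<phi>s}"
      then have "\<bar>formula_val G d K e (\<phi>s ! i)\<bar> \<le> M"
        using M[OF nth_mem admissible_subset[OF that free_vars_nth]] by simp
      then show "map (formula_val G d K e) \<phi>s ! i \<in> {-M..M}"
        using \<open>i \<in> {..<length \<phi>s}\<close> by auto
    qed
    from M'[OF this] show ?thesis by simp
  qed
  then show ?case by blast
next
  case (3 n i \<phi>)
  then obtain M where M: "\<And>e. admissible e (free_vars \<phi>) \<Longrightarrow> \<bar>formula_val G d K e \<phi>\<bar> \<le> M"
    by auto
  have "\<bar>formula_val G d K e (QSup n i \<phi>)\<bar> \<le> max \<bar>M\<bar> \<bar>Sup {}\<bar>"
    if "admissible e (free_vars (QSup n i \<phi>))" for e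
  proof (cases "K n = {}")
    case False
    have "\<bar>formula_val G d K (e((n, i) := a)) \<phi>\<bar> \<le> M" if "a \<in> K n" for a
      using \<open>admissible e _\<close> that by (intro M admissible_update) auto
    then have "\<bar>SUP a\<in>K n. formula_val G d K (e((n, i) := a)) \<phi>\<bar> \<le> M"
      using False by (intro cSup_abs_le) auto
    then show ?thesis by auto
  qed auto
  then show ?case by blast
next
  case (4 n i \<phi>)
  then obtain M where M: "\<And>e. admissible e (free_vars \<phi>) \<Longrightarrow> \<bar>formula_val G d K e \<phi>\<bar> \<le> M"
    by auto
  have "\<bar>formula_val G d K e (QInf n i \<phi>)\<bar> \<le> max \<bar>M\<bar> \<bar>Inf {}\<bar>"
    if "admissible e (free_vars (QInf n i \<phi>))" for e
  proof (cases "K n = {}")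
    case False
    have "\<bar>formula_val G d K (e((n, i) := a)) \<phi>\<bar> \<le> M" if "a \<in> K n" for a
      using \<open>admissible e _\<close> that by (intro M admissible_update) auto
    then have "\<bar>INF a\<in>K n. formula_val G d K (e((n, i) := a)) \<phi>\<bar> \<le> M"
      using False by (intro cInf_abs_ge) auto
    then show ?thesis by auto
  qed auto
  then show ?case by blast
qed

text \<open>For a connective this combines the uniform continuity of its finitely many arguments with its
  own uniform continuity on a cube, which contains their values by \<open>formula_bounded\<close>; taking
  suprema and infima preserves the modulus.\<close>

lemma formula_uniformly_continuous:
  "well_formed \<phi> \<Longrightarrow> \<epsilon> > 0 \<Longrightarrow>
    \<exists>\<delta>>0. \<forall>e e'. admissible e (free_vars \<phi>) \<longrightarrow> admissible e' (free_vars \<phi>) \<longrightarrow>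
    (\<forall>x\<in>free_vars \<phi>. d (e x) (e' x) < \<delta>) \<longrightarrow>
    \<bar>formula_val G d K e \<phi> - formula_val G d K e' \<phi>\<bar> < \<epsilon>"
proof (induction \<phi> arbitrary: \<epsilon> rule: well_formed.induct)
  case (1 s t)
  then obtain n where n: "has_sort s n" "has_sort t n" by auto
  obtain \<delta>s where \<delta>s: "\<delta>s > 0" "\<And>e e'. \<lbrakk>admissible e (term_vars s); admissible e' (term_vars s);
      \<forall>x\<in>term_vars s. d (e x) (e' x) < \<delta>s\<rbrakk> \<Longrightarrow> d (term_val G e s) (term_val G e' s) < \<epsilon> / 2"
    using term_uniformly_continuous[OF n(1)] 1(2) half_gt_zero by metis
  obtain \<delta>t where \<delta>t: "\<delta>t > 0" "\<And>e e'. \<lbrakk>admissible e (term_vars t); admissible e' (term_vars t);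
      \<forall>x\<in>term_vars t. d (e x) (e' x) < \<delta>t\<rbrakk> \<Longrightarrow> d (term_val G e t) (term_val G e' t) < \<epsilon> / 2"
    using term_uniformly_continuous[OF n(2)] 1(2) half_gt_zero by metis
  show ?case
  proof (intro exI[of _ "min \<delta>s \<delta>t"] conjI allI impI)
    show "min \<delta>s \<delta>t > 0" using \<delta>s \<delta>t by simp
    fix e e' assume e: "admissible e (free_vars (Dist s t))" "admissible e' (free_vars (Dist s t))"
      and close: "\<forall>x\<in>free_vars (Dist s t). d (e x) (e' x) < min \<delta>s \<delta>t"
    have adm: "admissible e (term_vars s)" "admissible e' (term_vars s)"
      "admissible e (term_vars t)" "admissible e' (term_vars t)"
      using e by auto
    let ?a = "term_val G e s" and ?a' = "term_val G e' s"
    let ?b = "term_val G e t" and ?b' = "term_val G e' t"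
    have in_G: "?a \<in> carrier G" "?a' \<in> carrier G" "?b \<in> carrier G" "?b' \<in> carrier G"
      using adm n term_val_in_K K_subset_carrier by blast+
    have "d ?a ?a' < \<epsilon> / 2" "d ?b ?b' < \<epsilon> / 2"
      using \<delta>s(2)[OF adm(1,2)] \<delta>t(2)[OF adm(3,4)] close by auto
    moreover have "d ?a ?b \<le> d ?a ?a' + d ?a' ?b" "d ?a' ?b \<le> d ?a' ?b' + d ?b' ?b"
      "d ?a' ?b' \<le> d ?a' ?a + d ?a ?b'" "d ?a ?b' \<le> d ?a ?b + d ?b ?b'"
      using in_G triangle by blast+
    moreover have "d ?a ?a' = d ?a' ?a" "d ?b ?b' = d ?b' ?b"
      by (rule commute)+
    ultimately show "\<bar>formula_val G d K e (Dist s t) - formula_val G d K e' (Dist s t)\<bar> < \<epsilon>"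
      by simp
  qed
next
  case (2 u \<phi>s)
  have wf: "\<And>\<phi>. \<phi> \<in> set \<phi>s \<Longrightarrow> well_formed \<phi>"
    and u: "continuous_map (powertop_real {..<length \<phi>s}) euclideanreal u"
    using 2(2) by simp_all
  have "\<exists>M. \<forall>\<phi>\<in>set \<phi>s. \<forall>e. admissible e (free_vars \<phi>) \<longrightarrow> \<bar>formula_val G d K e \<phi>\<bar> \<le> M"
    using wf formula_bounded by (auto intro!: finite_uniform_bound[OF finite_set])
  then obtain M where M: "\<And>\<phi> e. \<lbrakk>\<phi> \<in> set \<phi>s; admissible e (free_vars \<phi>)\<rbrakk>
      \<Longrightarrow> \<bar>formula_val G d K e \<phi>\<bar> \<le> M"
    by blast
  obtain \<eta> where "\<eta> > 0" and \<eta>: "\<And>x y. \<lbrakk>\<And>i. i < length \<phi>s \<Longrightarrow> \<bar>x i\<bar> \<le> M;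
      \<And>i. i < length \<phi>s \<Longrightarrow> \<bar>y i\<bar> \<le> M; \<And>i. i < length \<phi>s \<Longrightarrow> \<bar>x i - y i\<bar> < \<eta>\<rbrakk>
      \<Longrightarrow> \<bar>u (restrict x {..<length \<phi>s}) - u (restrict y {..<length \<phi>s})\<bar> < \<epsilon>"
    by (rule connective_uniformly_continuous[OF u 2(3), of M]) (blast intro: that)
  have "\<forall>\<phi>\<in>set \<phi>s. \<exists>\<delta>>0. \<forall>e e'. admissible e (free_vars \<phi>) \<longrightarrow> admissible e' (free_vars \<phi>) \<longrightarrow>
    (\<forall>x\<in>free_vars \<phi>. d (e x) (e' x) < \<delta>) \<longrightarrow>
    \<bar>formula_val G d K e \<phi> - formula_val G d K e' \<phi>\<bar> < \<eta>"
    using 2(1) wf \<open>\<eta> > 0\<close> by blast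
  then obtain \<delta>' where \<delta>': "\<And>\<phi>. \<phi> \<in> set \<phi>s \<Longrightarrow> \<delta>' \<phi> > 0"
    "\<And>\<phi> e e'. \<lbrakk>\<phi> \<in> set \<phi>s; admissible e (free_vars \<phi>); admissible e' (free_vars \<phi>);
      \<forall>x\<in>free_vars \<phi>. d (e x) (e' x) < \<delta>' \<phi>\<rbrakk>
      \<Longrightarrow> \<bar>formula_val G d K e \<phi> - formula_val G d K e' \<phi>\<bar> < \<eta>"
    by metis
  define \<delta> where "\<delta> = Min (insert 1 (\<delta>' ` set \<phi>s))"
  have "\<delta> > 0" unfolding \<delta>_def using \<delta>'(1) by (subst Min_gr_iff) auto
  have \<delta>_le: "\<delta> \<le> \<delta>' \<phi>" if "\<phi> \<in> set \<phi>s" for \<phi>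
    unfolding \<delta>_def using that by (intro Min_le) auto
  show ?case
  proof (intro exI[of _ \<delta>] conjI allI impI)
    fix e e' assume e: "admissible e (free_vars (Conn u \<phi>s))" "admissible e' (free_vars (Conn u \<phi>s))"
      and close: "\<forall>x\<in>free_vars (Conn u \<phi>s). d (e x) (e' x) < \<delta>"
    note adm = e[THEN admissible_subset, OF free_vars_nth]
    have "\<bar>formula_val G d K e (\<phi>s ! i) - formula_val G d K e' (\<phi>s ! i)\<bar> < \<eta>"
      if "i < length \<phi>s" for i
    proof (rule \<delta>'(2)[OF nth_mem[OF that] adm[OF that]], rule ballI)
      fix x assume "x \<in> free_vars (\<phi>s ! i)"
      then have "d (e x) (e' x) < \<delta>" using close free_vars_nth[OF that] by blast
      then show "d (e x) (e' x) < \<delta>' (\<phi>s ! i)" using \<delta>_le[OF nth_mem[OF that]] by linarith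
    qed
    then show "\<bar>formula_val G d K e (Conn u \<phi>s) - formula_val G d K e' (Conn u \<phi>s)\<bar> < \<epsilon>"
      unfolding formula_val.simps using M adm by (intro \<eta>) auto
  qed (fact \<open>\<delta> > 0\<close>)
next
  case (3 n i \<phi>)
  have wf: "well_formed \<phi>" using 3 by simp
  obtain M where M: "\<And>e. admissible e (free_vars \<phi>) \<Longrightarrow> \<bar>formula_val G d K e \<phi>\<bar> \<le> M"
    using formula_bounded[OF wf] by blast
  obtain \<delta> where \<delta>: "\<delta> > 0" "\<And>e e'. \<lbrakk>admissible e (free_vars \<phi>); admissible e' (free_vars \<phi>);
      \<forall>x\<in>free_vars \<phi>. d (e x) (e' x) < \<delta>\<rbrakk>
      \<Longrightarrow> \<bar>formula_val G d K e \<phi> - formula_val G d K e' \<phi>\<bar> < \<epsilon> / 2"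
    using 3(1)[OF wf, of "\<epsilon> / 2"] 3(3) half_gt_zero by metis
  show ?case
  proof (intro exI[of _ \<delta>] conjI allI impI)
    fix e e' assume e: "admissible e (free_vars (QSup n i \<phi>))" "admissible e' (free_vars (QSup n i \<phi>))"
      and close: "\<forall>x\<in>free_vars (QSup n i \<phi>). d (e x) (e' x) < \<delta>"
    have adm: "admissible (e((n, i) := a)) (free_vars \<phi>)" "admissible (e'((n, i) := a)) (free_vars \<phi>)"
      if "a \<in> K n" for a
      using that e by (auto intro: admissible_update)
    have "\<bar>formula_val G d K (e((n, i) := a)) \<phi> - formula_val G d K (e'((n, i) := a)) \<phi>\<bar> \<le> \<epsilon> / 2"
      if "a \<in> K n" for a
      using that close \<delta>(1)
      by (intro less_imp_le \<delta>(2) adm) (auto simp: dist_self_K)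
    then have "\<bar>formula_val G d K e (QSup n i \<phi>) - formula_val G d K e' (QSup n i \<phi>)\<bar> \<le> \<epsilon> / 2"
      unfolding formula_val.simps using M adm 3(3) by (intro cSUP_abs_diff_le[of _ _ _ M]) auto
    then show "\<bar>formula_val G d K e (QSup n i \<phi>) - formula_val G d K e' (QSup n i \<phi>)\<bar> < \<epsilon>"
      using 3(3) by simp
  qed (fact \<open>\<delta> > 0\<close>)
next
  case (4 n i \<phi>)
  have wf: "well_formed \<phi>" using 4 by simp
  obtain M where M: "\<And>e. admissible e (free_vars \<phi>) \<Longrightarrow> \<bar>formula_val G d K e \<phi>\<bar> \<le> M"
    using formula_bounded[OF wf] by blast
  obtain \<delta> where \<delta>: "\<delta> > 0" "\<And>e e'. \<lbrakk>admissible e (free_vars \<phi>); admissible e' (free_vars \<phi>);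
      \<forall>x\<in>free_vars \<phi>. d (e x) (e' x) < \<delta>\<rbrakk>
      \<Longrightarrow> \<bar>formula_val G d K e \<phi> - formula_val G d K e' \<phi>\<bar> < \<epsilon> / 2"
    using 4(1)[OF wf, of "\<epsilon> / 2"] 4(3) half_gt_zero by metis
  show ?case
  proof (intro exI[of _ \<delta>] conjI allI impI)
    fix e e' assume e: "admissible e (free_vars (QInf n i \<phi>))" "admissible e' (free_vars (QInf n i \<phi>))"
      and close: "\<forall>x\<in>free_vars (QInf n i \<phi>). d (e x) (e' x) < \<delta>"
    have adm: "admissible (e((n, i) := a)) (free_vars \<phi>)" "admissible (e'((n, i) := a)) (free_vars \<phi>)"
      if "a \<in> K n" for a
      using that e by (auto intro: admissible_update)
    have "\<bar>formula_val G d K (e((n, i) := a)) \<phi> - formula_val G d K (e'((n, i) := a)) \<phi>\<bar> \<le> \<epsilon> / 2"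
      if "a \<in> K n" for a
      using that close \<delta>(1)
      by (intro less_imp_le \<delta>(2) adm) (auto simp: dist_self_K)
    then have "\<bar>formula_val G d K e (QInf n i \<phi>) - formula_val G d K e' (QInf n i \<phi>)\<bar> \<le> \<epsilon> / 2"
      unfolding formula_val.simps using M adm 4(3) by (intro cINF_abs_diff_le[of _ _ _ M]) auto
    then show "\<bar>formula_val G d K e (QInf n i \<phi>) - formula_val G d K e' (QInf n i \<phi>)\<bar> < \<epsilon>"
      using 4(3) by simp
  qed (fact \<open>\<delta> > 0\<close>)
qed

section \<open>Density of the coded formulas\<close>

text \<open>The values of the arguments of a connective lie in a cube on which a step function approximates
  the connective. The arguments of that step function are themselves only approximations of the
  original ones; this error is controlled by the uniform continuity of the original connective,
  so the discontinuity of step functions does no harm.\<close>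

lemma codes_dense:
  "well_formed \<phi> \<Longrightarrow> \<epsilon> > 0 \<Longrightarrow> \<exists>c. \<forall>e. admissible e (free_vars \<phi>) \<longrightarrow>
    \<bar>formula_val G d K e \<phi> - formula_val G d K e (decode c)\<bar> < \<epsilon>"
proof (induction \<phi> arbitrary: \<epsilon> rule: well_formed.induct)
  case (1 s t)
  then show ?case by (intro exI[of _ "CDist s t"]) simp
next
  case (2 u \<phi>s)
  let ?k = "length \<phi>s"
  have wf: "\<And>\<phi>. \<phi> \<in> set \<phi>s \<Longrightarrow> well_formed \<phi>"
    and u: "continuous_map (powertop_real {..<?k}) euclideanreal u"
    using 2(2) by simp_all
  have "\<exists>M. \<forall>\<phi>\<in>set \<phi>s. \<forall>e. admissible e (free_vars \<phi>) \<longrightarrow> \<bar>formula_val G d K e \<phi>\<bar> \<le> M"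
    using wf formula_bounded by (auto intro!: finite_uniform_bound[OF finite_set])
  then obtain M where M: "\<And>\<phi> e. \<lbrakk>\<phi> \<in> set \<phi>s; admissible e (free_vars \<phi>)\<rbrakk>
      \<Longrightarrow> \<bar>formula_val G d K e \<phi>\<bar> \<le> M"
    by blast
  \<comment> \<open>The cube is enlarged by 1 to contain the values of the approximating arguments as well.\<close>
  obtain \<eta> where "\<eta> > 0" and \<eta>: "\<And>x y. \<lbrakk>\<And>i. i < ?k \<Longrightarrow> \<bar>x i\<bar> \<le> M + 1;
      \<And>i. i < ?k \<Longrightarrow> \<bar>y i\<bar> \<le> M + 1; \<And>i. i < ?k \<Longrightarrow> \<bar>x i - y i\<bar> < \<eta>\<rbrakk>
      \<Longrightarrow> \<bar>u (restrict x {..<?k}) - u (restrict y {..<?k})\<bar> < \<epsilon> / 2"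
    by (rule connective_uniformly_continuous[OF u half_gt_zero[OF 2(3)], of "M + 1"]) (blast intro: that)
  obtain N T where NT: "\<And>x. (\<And>i. i < ?k \<Longrightarrow> \<bar>x i\<bar> \<le> M + 1) \<Longrightarrow>
      \<bar>step_connective ?k N T x - u (restrict x {..<?k})\<bar> < \<epsilon> / 2"
    by (rule step_connective_approximates[OF u half_gt_zero[OF 2(3)], of "M + 1"]) (blast intro: that)
  have "\<forall>\<phi>\<in>set \<phi>s. \<exists>c. \<forall>e. admissible e (free_vars \<phi>) \<longrightarrow>
    \<bar>formula_val G d K e \<phi> - formula_val G d K e (decode c)\<bar> < min \<eta> 1"
    using \<open>\<eta> > 0\<close> by (intro ballI 2(1) wf) simp_all
  then obtain c where c: "\<And>\<phi> e. \<lbrakk>\<phi> \<in> set \<phi>s; admissible e (free_vars \<phi>)\<rbrakk>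
      \<Longrightarrow> \<bar>formula_val G d K e \<phi> - formula_val G d K e (decode (c \<phi>))\<bar> < min \<eta> 1"
    by metis
  show ?case
  proof (intro exI[of _ "CConn N T (map c \<phi>s)"] allI impI)
    fix e assume e: "admissible e (free_vars (Conn u \<phi>s))"
    note adm = admissible_subset[OF e free_vars_nth]
    define x where "x i = formula_val G d K e (\<phi>s ! i)" for i
    define y where "y i = formula_val G d K e (decode (c (\<phi>s ! i)))" for i
    have x: "\<bar>x i\<bar> \<le> M" and xy: "\<bar>x i - y i\<bar> < min \<eta> 1" if "i < ?k" for i
      unfolding x_def y_def using that by (auto intro!: M c[OF nth_mem adm] adm simp del: min_less_iff_conj)
    have y: "\<bar>y i\<bar> \<le> M + 1" if "i < ?k" for i
      using x[OF that] xy[OF that] by linarith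
    have "formula_val G d K e (Conn u \<phi>s) = u (restrict x {..<?k})"
      by (simp add: x_def cong: restrict_cong)
    moreover have "formula_val G d K e (decode (CConn N T (map c \<phi>s))) = step_connective ?k N T y"
      unfolding decode.simps formula_val.simps length_map
      by (rule step_connective_cong) (simp add: y_def)
    moreover have "\<bar>u (restrict x {..<?k}) - u (restrict y {..<?k})\<bar> < \<epsilon> / 2"
      using x xy y by (intro \<eta>) force+
    moreover have "\<bar>step_connective ?k N T y - u (restrict y {..<?k})\<bar> < \<epsilon> / 2"
      using y by (rule NT)
    ultimately show "\<bar>formula_val G d K e (Conn u \<phi>s)
        - formula_val G d K e (decode (CConn N T (map c \<phi>s)))\<bar> < \<epsilon>"
      by linarith
  qed
next
  case (3 n i \<phi>)
  have wf: "well_formed \<phi>" using 3 by simp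
  obtain M where M: "\<And>e. admissible e (free_vars \<phi>) \<Longrightarrow> \<bar>formula_val G d K e \<phi>\<bar> \<le> M"
    using formula_bounded[OF wf] by blast
  obtain c where c: "\<And>e. admissible e (free_vars \<phi>) \<Longrightarrow>
      \<bar>formula_val G d K e \<phi> - formula_val G d K e (decode c)\<bar> < \<epsilon> / 2"
    using 3(1)[OF wf half_gt_zero[OF 3(3)]] by blast
  show ?case
  proof (intro exI[of _ "CSup n i c"] allI impI)
    fix e assume "admissible e (free_vars (QSup n i \<phi>))"
    then have adm: "admissible (e((n, i) := a)) (free_vars \<phi>)" if "a \<in> K n" for a
      using that by (auto intro: admissible_update)
    have "\<bar>formula_val G d K e (QSup n i \<phi>) - formula_val G d K e (decode (CSup n i c))\<bar> \<le> \<epsilon> / 2"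
      unfolding formula_val.simps decode.simps
      using M adm c[OF adm] 3(3) by (intro cSUP_abs_diff_le[of _ _ _ M]) (auto intro: less_imp_le)
    then show "\<bar>formula_val G d K e (QSup n i \<phi>) - formula_val G d K e (decode (CSup n i c))\<bar> < \<epsilon>"
      using 3(3) by simp
  qed
next
  case (4 n i \<phi>)
  have wf: "well_formed \<phi>" using 4 by simp
  obtain M where M: "\<And>e. admissible e (free_vars \<phi>) \<Longrightarrow> \<bar>formula_val G d K e \<phi>\<bar> \<le> M"
    using formula_bounded[OF wf] by blast
  obtain c where c: "\<And>e. admissible e (free_vars \<phi>) \<Longrightarrow>
      \<bar>formula_val G d K e \<phi> - formula_val G d K e (decode c)\<bar> < \<epsilon> / 2"
    using 4(1)[OF wf half_gt_zero[OF 4(3)]] by blast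
  show ?case
  proof (intro exI[of _ "CInf n i c"] allI impI)
    fix e assume "admissible e (free_vars (QInf n i \<phi>))"
    then have adm: "admissible (e((n, i) := a)) (free_vars \<phi>)" if "a \<in> K n" for a
      using that by (auto intro: admissible_update)
    have "\<bar>formula_val G d K e (QInf n i \<phi>) - formula_val G d K e (decode (CInf n i c))\<bar> \<le> \<epsilon> / 2"
      unfolding formula_val.simps decode.simps
      using M adm c[OF adm] 4(3) by (intro cINF_abs_diff_le[of _ _ _ M]) (auto intro: less_imp_le)
    then show "\<bar>formula_val G d K e (QInf n i \<phi>) - formula_val G d K e (decode (CInf n i c))\<bar> < \<epsilon>"
      using 4(3) by simp
  qed
qed

section \<open>The Tarski-Vaught test\<close>

text \<open>A form of the Tarski-Vaught test that does not distinguish suprema from infima: every value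
  taken by a coded formula with parameters from \<open>D\<close>, as one variable ranges over its sort, is
  approximated with that variable in \<open>D\<close>.\<close>

definition tarski_vaught :: "'g set \<Rightarrow> bool" where
  "tarski_vaught D \<longleftrightarrow> D \<subseteq> carrier G \<and> D \<noteq> {} \<and>
     (\<forall>c e n i b \<epsilon>. range e \<subseteq> D \<longrightarrow> b \<in> K n \<longrightarrow> \<epsilon> > 0 \<longrightarrow>
        (\<exists>a\<in>D \<inter> K n. \<bar>formula_val G d K (e((n, i) := a)) (decode c)
           - formula_val G d K (e((n, i) := b)) (decode c)\<bar> < \<epsilon>))"

lemma tarski_vaughtD:
  assumes "tarski_vaught D" "range e \<subseteq> D" "b \<in> K n" "\<epsilon> > 0"
  obtains a where "a \<in> D" "a \<in> K n"
    "\<bar>formula_val G d K (e((n, i) := a)) (decode c)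
       - formula_val G d K (e((n, i) := b)) (decode c)\<bar> < \<epsilon>"
  using assms unfolding tarski_vaught_def by (metis IntE)

text \<open>The test for the formula that measures the distance of \<open>t\<close> to a fresh variable. The sort \<open>n\<close>
  of that variable is arbitrary, as codes need not decode to well-sorted formulas.\<close>

lemma tarski_vaught_term:
  assumes "tarski_vaught D" "range e \<subseteq> D" "b \<in> K n" "\<epsilon> > 0"
  obtains a where "a \<in> D" "a \<in> K n"
    "\<bar>d (term_val G e t) a - d (term_val G e t) b\<bar> < \<epsilon>"
proof -
  have "finite (snd ` term_vars t)" by (simp add: finite_term_vars)
  then obtain i where "i \<notin> snd ` term_vars t" using ex_new_if_finite infinite_UNIV_nat by blast
  then have "(n, i) \<notin> term_vars t" by force
  then have "term_val G (e((n, i) := a)) t = term_val G e t" for a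
    by (intro term_val_cong) auto
  moreover obtain a where "a \<in> D" "a \<in> K n"
    "\<bar>formula_val G d K (e((n, i) := a)) (decode (CDist t (Var n i)))
       - formula_val G d K (e((n, i) := b)) (decode (CDist t (Var n i)))\<bar> < \<epsilon>"
    using tarski_vaughtD[OF assms] by blast
  ultimately show thesis using that by simp
qed

text \<open>The Skolem hull with respect to the conditions \<open>q < \<phi> < r\<close> for rational \<open>q\<close> and \<open>r\<close> and coded
  formulas \<open>\<phi>\<close>, of which there are only countably many.\<close>

lemma exists_tarski_vaught:
  assumes "infinite A" "A \<subseteq> carrier G"
  obtains D where "A \<subseteq> D" "|D| \<le>o |A|" "tarski_vaught D"
proof -
  define assign where "assign xs x = xs ! to_nat x" for xs :: "'g list" and x :: "nat \<times> nat"
  define P :: "formula_code \<times> nat \<times> nat \<times> rat \<times> rat \<Rightarrow> 'g list \<Rightarrow> 'g \<Rightarrow> bool" where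
    "P = (\<lambda>(c, n, i, q, r) xs b. b \<in> K n \<and>
       of_rat q < formula_val G d K ((assign xs)((n, i) := b)) (decode c) \<and>
       formula_val G d K ((assign xs)((n, i) := b)) (decode c) < of_rat r)"
  obtain D where D: "A \<subseteq> D" "|D| \<le>o |A|"
    "\<And>j xs b. \<lbrakk>set xs \<subseteq> D; P j xs b\<rbrakk> \<Longrightarrow> \<exists>a\<in>D. P j xs a"
    using skolem_hull[OF assms(1), of P] by blast
  let ?D = "D \<inter> carrier G"
  have "tarski_vaught ?D"
    unfolding tarski_vaught_def
  proof (intro conjI allI impI)
    show "?D \<subseteq> carrier G" by blast
    show "?D \<noteq> {}" using D(1) assms infinite_imp_nonempty[OF assms(1)] by blast
    fix c and e :: "nat \<times> nat \<Rightarrow> 'g" and n i b and \<epsilon> :: real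
    assume e: "range e \<subseteq> ?D" and b: "b \<in> K n" and "\<epsilon> > 0"
    let ?f = "\<lambda>e a. formula_val G d K (e((n, i) := a)) (decode c)"
    \<comment> \<open>The list has to be long enough to record the values of all free variables.\<close>
    define m where "m = Suc (Max (insert 0 (to_nat ` free_vars (decode c))))"
    define xs where "xs = map (\<lambda>k. e (from_nat k)) [0..<m]"
    have "to_nat x < m" if "x \<in> free_vars (decode c)" for x
      unfolding m_def less_Suc_eq_le using that by (intro Max_ge) (auto simp: finite_free_vars)
    then have "assign xs x = e x" if "x \<in> free_vars (decode c)" for x
      using that by (simp add: assign_def xs_def)
    then have assign: "?f (assign xs) a = ?f e a" for a
      by (intro formula_val_cong) auto
    obtain q where q: "?f e b - \<epsilon> / 2 < of_rat q" "of_rat q < ?f e b"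
      using of_rat_dense[of "?f e b - \<epsilon> / 2" "?f e b"] \<open>\<epsilon> > 0\<close> by auto
    obtain r where r: "?f e b < of_rat r" "of_rat r < ?f e b + \<epsilon> / 2"
      using of_rat_dense[of "?f e b" "?f e b + \<epsilon> / 2"] \<open>\<epsilon> > 0\<close> by auto
    have "set xs \<subseteq> D" using e by (auto simp: xs_def)
    moreover have "P (c, n, i, q, r) xs b"
      unfolding P_def prod.case assign using b q r by blast
    ultimately obtain a where "a \<in> D" "P (c, n, i, q, r) xs a"
      using D(3) by blast
    then have "a \<in> D" "a \<in> K n" "of_rat q < ?f e a" "?f e a < of_rat r"
      unfolding P_def prod.case assign by blast+
    then show "\<exists>a\<in>?D \<inter> K n. \<bar>?f e a - ?f e b\<bar> < \<epsilon>"
      using q r K_subset_carrier by (intro bexI[of _ a]) auto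
  qed
  moreover have "|?D| \<le>o |A|"
    using D(2) card_of_mono1[of ?D D] ordLeq_transitive by blast
  ultimately show thesis
    using that[of ?D] D(1) assms(2) by blast
qed

text \<open>A sequence in \<open>D\<close> converging to a point of \<open>K n\<close> might meet \<open>K n\<close> nowhere. But if \<open>z \<in> D\<close> is close
  to \<open>x \<in> K n\<close>, then the Tarski-Vaught test for the distance to \<open>z\<close> gives a point of \<open>D \<inter> K n\<close>
  which is almost as close to \<open>z\<close> as \<open>x\<close> is.\<close>

lemma closure_sort_approx:
  assumes D: "tarski_vaught D" and x: "x \<in> mtopology closure_of D" "x \<in> K n" and "\<epsilon> > 0"
  obtains y where "y \<in> D" "y \<in> K n" "d x y < \<epsilon>"
proof -
  have "D \<subseteq> carrier G" using D by (simp add: tarski_vaught_def)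
  then obtain z where z: "z \<in> D" "d x z < \<epsilon> / 3"
    using x(1) \<open>\<epsilon> > 0\<close> in_closure_of_iff[OF Metric_space_axioms, of D x] by (meson divide_pos_pos zero_less_numeral)
  have "range (\<lambda>_. z) \<subseteq> D" "\<epsilon> / 3 > 0" using z(1) \<open>\<epsilon> > 0\<close> by auto
  then obtain y where y: "y \<in> D" "y \<in> K n"
    "\<bar>d (term_val G (\<lambda>_. z) (Var 0 0)) y - d (term_val G (\<lambda>_. z) (Var 0 0)) x\<bar> < \<epsilon> / 3"
    by (rule tarski_vaught_term[OF D _ x(2)])
  have "x \<in> carrier G" "y \<in> carrier G" "z \<in> carrier G"
    using x y(1) z(1) \<open>D \<subseteq> carrier G\<close> K_subset_carrier by blast+
  then have "d x y \<le> d x z + d z y" "d z x = d x z"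
    by (auto intro: triangle commute)
  moreover have "\<bar>d z y - d z x\<bar> < \<epsilon> / 3" using y(3) by simp
  ultimately have "d x y < \<epsilon>" using z(2) by argo
  then show thesis using that y by blast
qed

lemma closure_assignment_approx:
  assumes D: "tarski_vaught D" and e: "admissible e X"
      "\<And>x. x \<in> X \<Longrightarrow> e x \<in> mtopology closure_of D" and "\<delta> > 0"
  obtains e' where "range e' \<subseteq> D" "\<And>x. x \<in> X \<Longrightarrow> d (e x) (e' x) < \<delta>" "admissible e' X"
proof -
  have "\<exists>y. y \<in> D \<and> (x \<in> X \<longrightarrow> y \<in> K (fst x) \<and> d (e x) y < \<delta>)" for x
  proof (cases "x \<in> X")
    case True
    then have "e x \<in> K (fst x)" using e(1) by (simp add: admissible_def)
    then show ?thesis using closure_sort_approx[OF D e(2)[OF True] _ \<open>\<delta> > 0\<close>] by metis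
  qed (use D in \<open>auto simp: tarski_vaught_def\<close>)
  then obtain e' where e': "\<And>x. e' x \<in> D"
    "\<And>x. x \<in> X \<Longrightarrow> e' x \<in> K (fst x) \<and> d (e x) (e' x) < \<delta>"
    by metis
  show thesis
  proof
    show "range e' \<subseteq> D" using e'(1) by blast
    show "d (e x) (e' x) < \<delta>" if "x \<in> X" for x using e'(2)[OF that] by blast
    show "admissible e' X" using e'(2) by (simp add: admissible_def)
  qed
qed

text \<open>The group operations are known to be continuous only within the sorts, so the arguments have to
  be approximated inside their sorts. The value of \<open>t\<close> at approximations from \<open>D\<close> need not lie in \<open>D\<close>, but the
  Tarski-Vaught test shows that it is in the closure.\<close>

lemma term_val_in_closure:
  assumes D: "tarski_vaught D" and t: "has_sort t n"
    and e: "admissible e (term_vars t)" "\<And>x. x \<in> term_vars t \<Longrightarrow> e x \<in> mtopology closure_of D"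
  shows "term_val G e t \<in> mtopology closure_of D"
proof -
  have DG: "D \<subseteq> carrier G" "D \<noteq> {}" using D by (auto simp: tarski_vaught_def)
  have "\<exists>a\<in>D. d (term_val G e t) a < \<epsilon>" if "\<epsilon> > 0" for \<epsilon>
  proof -
    obtain \<delta> where \<delta>: "\<delta> > 0" "\<And>e'. \<lbrakk>admissible e' (term_vars t);
      \<forall>x\<in>term_vars t. d (e x) (e' x) < \<delta>\<rbrakk> \<Longrightarrow> d (term_val G e t) (term_val G e' t) < \<epsilon> / 2"
      using term_uniformly_continuous[OF t half_gt_zero[OF \<open>\<epsilon> > 0\<close>]] e(1) by blast
    obtain e' where e': "range e' \<subseteq> D" "\<And>x. x \<in> term_vars t \<Longrightarrow> d (e x) (e' x) < \<delta>"
      and adm': "admissible e' (term_vars t)"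
      using closure_assignment_approx[OF D e \<delta>(1)] by blast
    let ?b = "term_val G e' t"
    have b: "?b \<in> K n" using term_val_in_K[OF t adm'] .
    obtain a where a: "a \<in> D" "\<bar>d ?b a - d ?b ?b\<bar> < \<epsilon> / 2"
      by (rule tarski_vaught_term[OF D e'(1) b half_gt_zero[OF \<open>\<epsilon> > 0\<close>]])
    have "d (term_val G e t) a \<le> d (term_val G e t) ?b + d ?b a"
      using a(1) b DG term_val_in_K[OF t e(1)] K_subset_carrier by (intro triangle) blast+
    moreover have "d (term_val G e t) ?b < \<epsilon> / 2"
      using \<delta>(2)[OF adm'] e'(2) by blast
    ultimately show ?thesis using a dist_self_K[OF b] by (intro bexI[of _ a]) auto
  qed
  moreover have "term_val G e t \<in> carrier G"
    using term_val_in_K[OF t e(1)] K_subset_carrier by blast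
  ultimately show ?thesis
    using in_closure_of_iff[OF Metric_space_axioms DG(1)] by blast
qed

lemma closure_subgroup:
  assumes D: "tarski_vaught D"
  shows "subgroup (mtopology closure_of D) G"
proof (rule subgroup.intro)
  let ?H = "mtopology closure_of D"
  show "?H \<subseteq> carrier G" by (metis closure_of_subset_topspace topspace_mtopology)
  have one: "\<exists>n. x \<in> K n" if "x \<in> ?H" for x
    using that \<open>?H \<subseteq> carrier G\<close> carrier_eq by blast
  show "\<one> \<in> ?H"
    using term_val_in_closure[OF D has_sort.intros(2), of "\<lambda>_. \<one>" 0] by (simp add: admissible_def)
  show "x \<otimes> y \<in> ?H" if "x \<in> ?H" "y \<in> ?H" for x y
  proof -
    obtain n m where "x \<in> K n" "y \<in> K m"
      using one[OF \<open>x \<in> ?H\<close>] one[OF \<open>y \<in> ?H\<close>] by blast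
    then have "x \<in> K (max n m)" "y \<in> K (max n m)"
      using incseq_K by (meson incseqD max.cobounded1 max.cobounded2 subsetD)+
    then show ?thesis
      using term_val_in_closure[OF D has_sort.intros(3)[OF has_sort.intros(1) has_sort.intros(1)],
          of "(\<lambda>_. y)((max n m, 0) := x)" "max n m" 0 1] that
      by (simp add: admissible_def)
  qed
  show "inv x \<in> ?H" if x: "x \<in> ?H" for x
  proof -
    obtain n where "x \<in> K n" using one[OF x] by blast
    then show ?thesis
      using term_val_in_closure[OF D has_sort.intros(4)[OF has_sort.intros(1)], of "\<lambda>_. x" n 0] x
      by (simp add: admissible_def)
  qed
qed

text \<open>The Tarski-Vaught test passes from \<open>D\<close> and coded formulas to the closure of \<open>D\<close> and all
  formulas: move the parameters into \<open>D\<close> by the uniform continuity of \<open>\<phi>\<close>, replace \<open>\<phi>\<close> by a code,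
  find the witness, and go back. These are five steps, each costing \<open>\<epsilon> / 5\<close>.\<close>

lemma tarski_vaught_test:
  assumes D: "tarski_vaught D" and \<phi>: "well_formed \<phi>"
    and e: "admissible e (free_vars \<phi> - {(n, i)})"
      "\<And>x. x \<in> free_vars \<phi> - {(n, i)} \<Longrightarrow> e x \<in> mtopology closure_of D"
    and b: "b \<in> K n" and "\<epsilon> > 0"
  obtains a where "a \<in> K n \<inter> mtopology closure_of D"
    "\<bar>formula_val G d K (e((n, i) := a)) \<phi> - formula_val G d K (e((n, i) := b)) \<phi>\<bar> < \<epsilon>"
proof -
  have DG: "D \<subseteq> carrier G" "D \<noteq> {}" using D by (auto simp: tarski_vaught_def)
  have \<epsilon>5: "\<epsilon> / 5 > 0" using \<open>\<epsilon> > 0\<close> by simp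
  let ?X = "free_vars \<phi> - {(n, i)}"
  let ?f = "\<lambda>e a. formula_val G d K (e((n, i) := a)) \<phi>"
  obtain \<delta> where \<delta>: "\<delta> > 0" "\<And>e e'. \<lbrakk>admissible e (free_vars \<phi>); admissible e' (free_vars \<phi>);
      \<forall>x\<in>free_vars \<phi>. d (e x) (e' x) < \<delta>\<rbrakk>
      \<Longrightarrow> \<bar>formula_val G d K e \<phi> - formula_val G d K e' \<phi>\<bar> < \<epsilon> / 5"
    using formula_uniformly_continuous[OF \<phi> \<epsilon>5] by blast
  obtain e' where e': "range e' \<subseteq> D" "\<And>x. x \<in> ?X \<Longrightarrow> d (e x) (e' x) < \<delta>"
    and adm': "admissible e' ?X"
    using closure_assignment_approx[OF D e \<delta>(1)] by blast
  then have adm: "admissible (e((n, i) := a)) (free_vars \<phi>)" "admissible (e'((n, i) := a)) (free_vars \<phi>)"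
    if "a \<in> K n" for a
    using that e(1) by (auto intro: admissible_update)
  have move: "\<bar>?f e a - ?f e' a\<bar> < \<epsilon> / 5" if "a \<in> K n" for a
    using that e'(2) \<delta>(1) by (intro \<delta>(2) adm) (auto simp: dist_self_K)
  obtain c where c: "\<And>e. admissible e (free_vars \<phi>) \<Longrightarrow>
      \<bar>formula_val G d K e \<phi> - formula_val G d K e (decode c)\<bar> < \<epsilon> / 5"
    using codes_dense[OF \<phi> \<epsilon>5] by blast
  obtain a where a: "a \<in> D" "a \<in> K n"
    "\<bar>formula_val G d K (e'((n, i) := a)) (decode c)
       - formula_val G d K (e'((n, i) := b)) (decode c)\<bar> < \<epsilon> / 5"
    by (rule tarski_vaughtD[OF D e'(1) b \<epsilon>5])
  have "\<bar>?f e a - ?f e b\<bar> < \<epsilon>"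
    using move[OF a(2)] move[OF b] c[OF adm(2)[OF a(2)]] c[OF adm(2)[OF b]] a(3) by linarith
  moreover have "a \<in> mtopology closure_of D"
    using a(1) DG(1) closure_of_subset[of D mtopology] by auto
  ultimately show thesis using that a(2) by blast
qed

text \<open>Only the quantifiers need an argument: the Tarski-Vaught test shows that restricting a
  quantifier to the closure of \<open>D\<close> changes neither suprema nor infima.\<close>

lemma closure_continuously_elementary:
  assumes D: "tarski_vaught D"
  shows "continuously_elementary G d K (mtopology closure_of D)"
proof -
  let ?H = "mtopology closure_of D"
  let ?G = "G\<lparr>carrier := ?H\<rparr>"
  interpret H: subgroup ?H G using closure_subgroup[OF D] .
  have term_eq: "term_val ?G e t = term_val G e t \<and> term_val G e t \<in> ?H"
    if "\<And>x. x \<in> term_vars t \<Longrightarrow> e x \<in> ?H" for e t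
    using that by (induction t) (auto simp: m_inv_consistent H.subgroup_axioms)
  have "formula_val ?G d (\<lambda>n. K n \<inter> ?H) e \<phi> = formula_val G d K e \<phi>"
    if "well_formed \<phi>" "\<And>x. x \<in> free_vars \<phi> \<Longrightarrow> e x \<in> K (fst x) \<inter> ?H" for \<phi> e
    using that
  proof (induction \<phi> arbitrary: e rule: well_formed.induct)
    case (1 s t)
    then show ?case using term_eq[of s e] term_eq[of t e] by auto
  next
    case (2 u \<phi>s)
    have "map (formula_val ?G d (\<lambda>n. K n \<inter> ?H) e) \<phi>s = map (formula_val G d K e) \<phi>s"
    proof (rule map_cong[OF refl])
      fix \<psi> assume "\<psi> \<in> set \<phi>s"
      with 2(2,3) show "formula_val ?G d (\<lambda>n. K n \<inter> ?H) e \<psi> = formula_val G d K e \<psi>"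
        by (intro 2(1)) auto
    qed
    then show ?case by (simp only: formula_val.simps)
  next
    case (3 n i \<phi>)
    let ?f = "\<lambda>a. formula_val G d K (e((n, i) := a)) \<phi>"
    have wf: "well_formed \<phi>" using 3 by simp
    have e: "e x \<in> K (fst x)" "e x \<in> ?H" if "x \<in> free_vars \<phi> - {(n, i)}" for x
      using 3(3)[of x] that by auto
    then have adm: "admissible e (free_vars \<phi> - {(n, i)})" by (simp add: admissible_def)
    obtain M where M: "\<And>e. admissible e (free_vars \<phi>) \<Longrightarrow> \<bar>formula_val G d K e \<phi>\<bar> \<le> M"
      using formula_bounded[OF wf] by blast
    have "formula_val ?G d (\<lambda>n. K n \<inter> ?H) e (QSup n i \<phi>) = (SUP a\<in>K n \<inter> ?H. ?f a)"
      unfolding formula_val.simps using e by (intro SUP_cong refl 3(1)[OF wf]) auto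
    also have "\<dots> = (SUP a\<in>K n. ?f a)"
    proof (rule cSUP_dense_subset_eq)
      show "\<bar>?f a\<bar> \<le> M" if "a \<in> K n" for a
        using M admissible_update[OF adm that] .
      show "\<exists>a\<in>K n \<inter> ?H. \<bar>?f a - ?f b\<bar> < \<epsilon>" if "b \<in> K n" "\<epsilon> > 0" for b \<epsilon>
        using tarski_vaught_test[OF D wf adm e(2) that] by blast
    qed simp
    finally show ?case by simp
  next
    case (4 n i \<phi>)
    let ?f = "\<lambda>a. formula_val G d K (e((n, i) := a)) \<phi>"
    have wf: "well_formed \<phi>" using 4 by simp
    have e: "e x \<in> K (fst x)" "e x \<in> ?H" if "x \<in> free_vars \<phi> - {(n, i)}" for x
      using 4(3)[of x] that by auto
    then have adm: "admissible e (free_vars \<phi> - {(n, i)})" by (simp add: admissible_def)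
    obtain M where M: "\<And>e. admissible e (free_vars \<phi>) \<Longrightarrow> \<bar>formula_val G d K e \<phi>\<bar> \<le> M"
      using formula_bounded[OF wf] by blast
    have "formula_val ?G d (\<lambda>n. K n \<inter> ?H) e (QInf n i \<phi>) = (INF a\<in>K n \<inter> ?H. ?f a)"
      unfolding formula_val.simps using e by (intro INF_cong refl 4(1)[OF wf]) auto
    also have "\<dots> = (INF a\<in>K n. ?f a)"
    proof (rule cINF_dense_subset_eq)
      show "\<bar>?f a\<bar> \<le> M" if "a \<in> K n" for a
        using M admissible_update[OF adm that] .
      show "\<exists>a\<in>K n \<inter> ?H. \<bar>?f a - ?f b\<bar> < \<epsilon>" if "b \<in> K n" "\<epsilon> > 0" for b \<epsilon>
        using tarski_vaught_test[OF D wf adm e(2) that] by blast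
    qed simp
    finally show ?case by simp
  qed
  then show ?thesis
    unfolding continuously_elementary_def by fastforce
qed

end

section \<open>Elementary subgroups without property FH\<close>

lemma F_action_subgroup:
  assumes "F_action F G d K V \<alpha>" "subgroup H G"
  shows "F_action F (G\<lparr>carrier := H\<rparr>) d (\<lambda>i. K i \<inter> H) V \<alpha>"
proof -
  have "group_action (G\<lparr>carrier := H\<rparr>) V \<alpha>"
    using assms group_action.induced_action
    unfolding F_action_def isometric_action_def by blast
  then show ?thesis
    using assms(1) subgroup.subset[OF assms(2)]
    unfolding F_action_def isometric_action_def has_modulus2_def has_modulus_def by auto
qed

theorem proposition2p9:
  fixes G :: "('g, 'm) monoid_scheme"
    and d :: "'g \<Rightarrow> 'g \<Rightarrow> real"
    and K :: "nat \<Rightarrow> 'g set"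
    and \<gamma>m \<gamma>i :: "nat \<Rightarrow> real \<Rightarrow> real"
    and \<nu> :: "nat \<Rightarrow> nat \<Rightarrow> nat"
    and F :: "nat \<Rightarrow> nat \<Rightarrow> real \<Rightarrow> real"
    and V :: "'v::real_inner set"
    and \<alpha> :: "'g \<Rightarrow> 'v \<Rightarrow> 'v"
    and C :: "'g set"
  assumes "\<And>n. mono (\<nu> n)" and "\<And>m. mono (\<lambda>n. \<nu> n m)"
    and "\<And>n m. modulus (F n m)"
    and "metric_group_presentation G d K \<gamma>m \<gamma>i"
    and "K_GH_structure G d K \<gamma>m \<gamma>i \<nu> F V \<alpha>"
    and "\<not> (\<exists>v\<in>V. fixed_point G \<alpha> v)"
    and "C \<subseteq> carrier G" and "infinite C"
  shows "\<exists>H. subgroup H G \<and>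
           closedin (Metric_space.mtopology (carrier G) d) H \<and>
           continuously_elementary G d K H \<and>
           C \<subseteq> H \<and>
           ordIso2
             (density_character (subtopology (Metric_space.mtopology (carrier G) d) H))
             (density_character (subtopology (Metric_space.mtopology (carrier G) d) C)) \<and>
           \<not> property_FH TYPE('v) F (G\<lparr>carrier := H\<rparr>) d (\<lambda>i. K i \<inter> H)"
proof -
  interpret K_GH_structure G d K \<gamma>m \<gamma>i \<nu> F V \<alpha> by fact
  note M = Metric_space_axioms
  have "isometric_action G V \<alpha>" using action by (simp add: F_action_def)
  then obtain g :: "nat \<Rightarrow> 'g" where g: "range g \<subseteq> carrier G"
    "\<And>H v. \<lbrakk>range g \<subseteq> H; v \<in> V\<rbrakk> \<Longrightarrow> \<not> fixed_point (G\<lparr>carrier := H\<rparr>) \<alpha> v"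
    using no_fixed_point_witnesses assms(6) by metis
  obtain D0 where D0: "dense_subset (subtopology mtopology C) D0"
      and card_D0: "density_character (subtopology mtopology C) = |D0|"
    using density_character_least by blast
  have "infinite D0"
    using dense_subset_infinite[OF M assms(7,8) D0] .
  have "D0 \<subseteq> C" using D0 by (auto simp: dense_subset_def)
  have "|range g| \<le>o |D0|"
    using \<open>infinite D0\<close> card_of_image[of g UNIV] infinite_iff_card_of_nat ordLeq_transitive by blast
  then have card_A: "|D0 \<union> range g| \<le>o |D0|"
    using card_of_Un_le_infinite[OF \<open>infinite D0\<close>] card_of_mono1[of D0 D0] by blast
  have A: "infinite (D0 \<union> range g)" "D0 \<union> range g \<subseteq> carrier G"
    using \<open>infinite D0\<close> \<open>D0 \<subseteq> C\<close> assms(7) g(1) by auto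
  obtain D where D: "D0 \<union> range g \<subseteq> D" "|D| \<le>o |D0 \<union> range g|" "tarski_vaught D"
    using exists_tarski_vaught[OF A] by blast
  let ?H = "mtopology closure_of D"
  \<comment> \<open>\<open>?H\<close> contains \<open>C\<close> since it contains the closure of \<open>D0\<close>.\<close>
  have DG: "D \<subseteq> carrier G" using D(3) by (simp add: tarski_vaught_def)
  then have "D \<subseteq> ?H" using closure_of_subset[of D mtopology] by simp
  have H: "subgroup ?H G" using closure_subgroup[OF D(3)] .
  have "?H \<subseteq> carrier G" using subgroup.subset[OF H] .
  have "C \<subseteq> ?H"
  proof
    fix x assume "x \<in> C"
    then show "x \<in> ?H"
      using dense_subsetD[OF M assms(7) D0] D(1) assms(7) in_closure_of_iff[OF M DG]
      by (meson Un_subset_iff subsetD)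
  qed
  have "dense_subset (subtopology mtopology ?H) D"
    using dense_subsetI[OF M \<open>?H \<subseteq> carrier G\<close> \<open>D \<subseteq> ?H\<close>] in_closure_of_iff[OF M DG] by blast
  then have "density_character (subtopology mtopology ?H) \<le>o |D|"
    using density_character_least[of "subtopology mtopology ?H"] by auto
  also note D(2)
  also note card_A
  finally have "density_character (subtopology mtopology ?H) \<le>o density_character (subtopology mtopology C)"
    unfolding card_D0 .
  moreover have "density_character (subtopology mtopology C) \<le>o density_character (subtopology mtopology ?H)"
    using density_character_mono[OF M \<open>C \<subseteq> ?H\<close> \<open>?H \<subseteq> carrier G\<close> assms(8)] .
  ultimately have "density_character (subtopology mtopology ?H) =o density_character (subtopology mtopology C)"
    by (simp add: ordIso_iff_ordLeq)
  moreover have "\<not> property_FH TYPE('v) F (G\<lparr>carrier := ?H\<rparr>) d (\<lambda>i. K i \<inter> ?H)"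
    using F_action_subgroup[OF action H] g(2)[of ?H] D(1) \<open>D \<subseteq> ?H\<close>
    unfolding property_FH_def by blast
  ultimately show ?thesis
    using H \<open>C \<subseteq> ?H\<close> closure_continuously_elementary[OF D(3)] closedin_closure_of by blast
qed

end
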